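(* For every context-free language $L$, membership of the current word in $L$ can be maintained in $\mathrm{DynFOLL}$ under changes of size $\mathrm{polylog}(n)$, i.e., changes that modify the symbols at up to $(\log n)^c$ positions at once (for an arbitrary fixed constant $c$).
   Context: Dynamic complexity setting. A word of length $n$ is represented as a structure with domain $\{0,\dots,n-1\}$ (positions, with linear order) and a unary relation per alphabet symbol. A dynamic program stores auxiliary relations over the same domain; for each auxiliary relation and change operation it has an update program which, evaluated on the changed input with the old auxiliary relations, defines the new auxiliary relation. The initial input is empty and initial auxiliary relations are first-order definable from it. The program maintains the query if after every sequence of allowed changes a designated auxiliary (0-ary) relation holds iff the current word is in $L$. $\mathrm{DynFOLL}$: update programs are DLOGTIME-uniform polynomial-size circuits of depth $O(\log\log n)$ with NOT gates and unbounded fan-in AND/OR gates, equivalently a first-order formula with $\leq,+,\times$ iterated $O(\log\log n)$ times. *)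

theory Defs
  imports Complex_Main
begin

section \<open>Context-free languages\<close>

datatype ('n, 'a) symb = Nt 'n | Tm 'a

type_synonym ('n, 'a) prods = "('n \<times> ('n, 'a) symb list) set"

inductive derive1 :: "('n, 'a) prods \<Rightarrow> ('n, 'a) symb list \<Rightarrow> ('n, 'a) symb list \<Rightarrow> bool"
  for P where
  "(A, \<alpha>) \<in> P \<Longrightarrow> derive1 P (u @ [Nt A] @ v) (u @ \<alpha> @ v)"

definition lang :: "('n, 'a) prods \<Rightarrow> 'n \<Rightarrow> 'a list set" where
  "lang P S = {w. (derive1 P)\<^sup>*\<^sup>* [Nt S] (map Tm w)}"

text \<open>Only finitely many nonterminals occur in a finite set of productions, so naming them by
  natural numbers is no restriction. Alphabets are finite types.\<close>

definition context_free :: "'a::finite list set \<Rightarrow> bool" where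
  "context_free L \<longleftrightarrow> (\<exists>(P :: (nat, 'a) prods) S. finite P \<and> L = lang P S)"


section \<open>First-order logic with arithmetic on an initial segment of the naturals\<close>

text \<open>Variables are natural numbers; \<open>'r\<close> is the type of relation symbols. Addition and
  multiplication are ternary relations on the domain.\<close>

datatype 'r fo =
    Rel 'r "nat list"
  | Eq nat nat
  | Le nat nat
  | Plus nat nat nat
  | Times nat nat nat
  | Neg "'r fo"
  | Conj "'r fo" "'r fo"
  | Disj "'r fo" "'r fo"
  | Ex nat "'r fo"
  | All nat "'r fo"

primrec sat :: "nat \<Rightarrow> ('r \<Rightarrow> nat list set) \<Rightarrow> (nat \<Rightarrow> nat) \<Rightarrow> 'r fo \<Rightarrow> bool" where
  "sat n I s (Rel r xs) \<longleftrightarrow> map s xs \<in> I r"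
| "sat n I s (Eq x y) \<longleftrightarrow> s x = s y"
| "sat n I s (Le x y) \<longleftrightarrow> s x \<le> s y"
| "sat n I s (Plus x y z) \<longleftrightarrow> s x + s y = s z"
| "sat n I s (Times x y z) \<longleftrightarrow> s x * s y = s z"
| "sat n I s (Neg \<phi>) \<longleftrightarrow> \<not> sat n I s \<phi>"
| "sat n I s (Conj \<phi> \<psi>) \<longleftrightarrow> sat n I s \<phi> \<and> sat n I s \<psi>"
| "sat n I s (Disj \<phi> \<psi>) \<longleftrightarrow> sat n I s \<phi> \<or> sat n I s \<psi>"
| "sat n I s (Ex x \<phi>) \<longleftrightarrow> (\<exists>a<n. sat n I (s(x := a)) \<phi>)"
| "sat n I s (All x \<phi>) \<longleftrightarrow> (\<forall>a<n. sat n I (s(x := a)) \<phi>)"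

text \<open>\<open>wf_fo ar V \<phi>\<close>: the free variables of \<open>\<phi>\<close> lie in \<open>V\<close>, and every relation symbol occurring
  in \<open>\<phi>\<close> belongs to the signature \<open>ar\<close> (\<open>None\<close> means not available) and is used with its arity.\<close>

primrec wf_fo :: "('r \<Rightarrow> nat option) \<Rightarrow> nat set \<Rightarrow> 'r fo \<Rightarrow> bool" where
  "wf_fo ar V (Rel r xs) \<longleftrightarrow> ar r = Some (length xs) \<and> set xs \<subseteq> V"
| "wf_fo ar V (Eq x y) \<longleftrightarrow> {x, y} \<subseteq> V"
| "wf_fo ar V (Le x y) \<longleftrightarrow> {x, y} \<subseteq> V"
| "wf_fo ar V (Plus x y z) \<longleftrightarrow> {x, y, z} \<subseteq> V"
| "wf_fo ar V (Times x y z) \<longleftrightarrow> {x, y, z} \<subseteq> V"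
| "wf_fo ar V (Neg \<phi>) \<longleftrightarrow> wf_fo ar V \<phi>"
| "wf_fo ar V (Conj \<phi> \<psi>) \<longleftrightarrow> wf_fo ar V \<phi> \<and> wf_fo ar V \<psi>"
| "wf_fo ar V (Disj \<phi> \<psi>) \<longleftrightarrow> wf_fo ar V \<phi> \<and> wf_fo ar V \<psi>"
| "wf_fo ar V (Ex x \<phi>) \<longleftrightarrow> wf_fo ar (insert x V) \<phi>"
| "wf_fo ar V (All x \<phi>) \<longleftrightarrow> wf_fo ar (insert x V) \<phi>"

text \<open>The \<open>k\<close>-ary relation on \<open>{0..<n}\<close> defined by a formula with free variables \<open>0, \<dots>, k - 1\<close>.\<close>

definition defrel :: "nat \<Rightarrow> ('r \<Rightarrow> nat list set) \<Rightarrow> nat \<Rightarrow> 'r fo \<Rightarrow> nat list set" where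
  "defrel n I k \<phi> =
     {t. length t = k \<and> set t \<subseteq> {..<n} \<and> sat n I (\<lambda>i. if i < k then t ! i else 0) \<phi>}"


section \<open>Words as structures\<close>

text \<open>An input structure of size \<open>n\<close> is a list of length \<open>n\<close>; \<open>None\<close> marks a position carrying no
  symbol, which contributes the empty word to the represented word.\<close>

type_synonym 'a input = "'a option list"

definition word_of :: "'a input \<Rightarrow> 'a list" where
  "word_of w = List.map_filter id w"

definition letter_rel :: "'a input \<Rightarrow> 'a \<Rightarrow> nat list set" where
  "letter_rel w a = {[p] | p. p < length w \<and> w ! p = Some a}"

definition empty_input :: "nat \<Rightarrow> 'a input" where
  "empty_input n = replicate n None"

definition change :: "real \<Rightarrow> 'a input \<Rightarrow> 'a input \<Rightarrow> bool" where
  "change m w w' \<longleftrightarrow> length w' = length w \<and> real (card {p. p < length w \<and> w ! p \<noteq> w' ! p}) \<le> m"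


section \<open>Dynamic programs with iterated first-order updates\<close>

datatype 'a rsym = Letter 'a | Aux nat | Work nat

text \<open>An update program has finitely many work relations, each given by its arity and a first-order
  step formula. They start out empty and are redefined simultaneously
  \<open>iters * (\<lceil>log log n\<rceil> + 1)\<close> times; \<open>result\<close> then defines the new auxiliary relation. The step
  formulas need not be positive. (The summand 1 is for \<open>n \<le> 2\<close>, where \<open>log log n\<close> vanishes or is
  undefined.) Each step is a uniform circuit of constant depth and polynomial size.\<close>

record 'a update =
  work :: "(nat \<times> 'a rsym fo) list"
  iters :: nat
  result :: "'a rsym fo"

record 'a auxrel =
  arity :: nat
  init :: "'a fo"
  upd :: "'a update"

record 'a dynprog =
  auxs :: "'a auxrel list"
  answer :: nat

definition loglog :: "nat \<Rightarrow> nat" where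
  "loglog n = nat \<lceil>log 2 (log 2 (real n))\<rceil>"

fun interp :: "'a input \<Rightarrow> (nat \<Rightarrow> nat list set) \<Rightarrow> (nat \<Rightarrow> nat list set) \<Rightarrow> 'a rsym \<Rightarrow> nat list set"
  where
  "interp w A W (Letter a) = letter_rel w a"
| "interp w A W (Aux i) = A i"
| "interp w A W (Work j) = W j"

definition work_step ::
  "'a update \<Rightarrow> 'a input \<Rightarrow> (nat \<Rightarrow> nat list set) \<Rightarrow> (nat \<Rightarrow> nat list set) \<Rightarrow> nat \<Rightarrow> nat list set" where
  "work_step u w A W j =
     (if j < length (work u)
      then defrel (length w) (interp w A W) (fst (work u ! j)) (snd (work u ! j)) else {})"

definition run_update :: "nat \<Rightarrow> 'a update \<Rightarrow> 'a input \<Rightarrow> (nat \<Rightarrow> nat list set) \<Rightarrow> nat list set" where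
  "run_update k u w A =
     (let W = (work_step u w A ^^ (iters u * (loglog (length w) + 1))) (\<lambda>_. {})
      in defrel (length w) (interp w A W) k (result u))"

definition init_aux :: "'a dynprog \<Rightarrow> nat \<Rightarrow> nat \<Rightarrow> nat list set" where
  "init_aux P n i =
     (if i < length (auxs P)
      then defrel n (letter_rel (empty_input n)) (arity (auxs P ! i)) (init (auxs P ! i)) else {})"

text \<open>\<open>w\<close> is the changed input, \<open>A\<close> the old auxiliary relations.\<close>

definition next_aux ::
  "'a dynprog \<Rightarrow> 'a input \<Rightarrow> (nat \<Rightarrow> nat list set) \<Rightarrow> nat \<Rightarrow> nat list set" where
  "next_aux P w A i =
     (if i < length (auxs P)
      then run_update (arity (auxs P ! i)) (upd (auxs P ! i)) w A else {})"

fun sig :: "'a dynprog \<Rightarrow> 'a update \<Rightarrow> 'a rsym \<Rightarrow> nat option" where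
  "sig P u (Letter a) = Some 1"
| "sig P u (Aux i) = (if i < length (auxs P) then Some (arity (auxs P ! i)) else None)"
| "sig P u (Work j) = (if j < length (work u) then Some (fst (work u ! j)) else None)"

definition wf_dynprog :: "'a dynprog \<Rightarrow> bool" where
  "wf_dynprog P \<longleftrightarrow>
     answer P < length (auxs P) \<and> arity (auxs P ! answer P) = 0 \<and>
     (\<forall>r \<in> set (auxs P).
        wf_fo (\<lambda>_. Some 1) {..<arity r} (init r) \<and>
        wf_fo (sig P (upd r)) {..<arity r} (result (upd r)) \<and>
        (\<forall>(k, \<phi>) \<in> set (work (upd r)). wf_fo (sig P (upd r)) {..<k} \<phi>))"

text \<open>\<open>reach P m n w A\<close>: some sequence of changes of at most \<open>m\<close> positions each leads from the
  empty input of size \<open>n\<close> to \<open>w\<close>, with \<open>A\<close> the auxiliary relations then stored by \<open>P\<close>.\<close>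

inductive reach :: "'a dynprog \<Rightarrow> real \<Rightarrow> nat \<Rightarrow> 'a input \<Rightarrow> (nat \<Rightarrow> nat list set) \<Rightarrow> bool"
  for P m n where
  start: "reach P m n (empty_input n) (init_aux P n)"
| step: "reach P m n w A \<Longrightarrow> change m w w' \<Longrightarrow> reach P m n w' (next_aux P w' A)"

text \<open>A 0-ary relation holds iff it contains the empty tuple.\<close>

definition maintains :: "'a dynprog \<Rightarrow> (nat \<Rightarrow> real) \<Rightarrow> 'a list set \<Rightarrow> bool" where
  "maintains P s L \<longleftrightarrow>
     (\<forall>n w A. reach P (s n) n w A \<longrightarrow> ([] \<in> A (answer P) \<longleftrightarrow> word_of w \<in> L))"

text \<open>\<open>DynFOLL s\<close>: the languages maintainable under changes of at most \<open>s n\<close> positions on inputs of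
  size \<open>n\<close>.\<close>

definition DynFOLL :: "(nat \<Rightarrow> real) \<Rightarrow> 'a::finite list set set" where
  "DynFOLL s = {L. \<exists>P. wf_dynprog P \<and> maintains P s L}"

end

theory Submission
  imports Defs
begin

text \<open>For a binary normal form of the grammar, store for all intervals which nonterminals derive the
  factor on it (spans), and which nonterminals derive it with a subinterval replaced by another
  nonterminal (gaps). After a change of \<open>m\<close> positions, spans and gaps not touching a changed
  position are unaffected; all others are rebuilt by combining smaller ones. A span with fewer than
  \<open>2 ^ (t + 1)\<close> changed positions is cut at the lowest parse tree node below which at least
  \<open>2 ^ t\<close> of them occur: the part above is a gap, and the two parts below are spans, each with fewer
  than \<open>2 ^ t\<close> changes. Gaps are cut likewise along the path to the replaced nonterminal, except
  that the subtree branching off there is an arbitrary span. So two rounds of first-order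
  definable combinations halve the number of changes, and \<open>m \<le> (log n) ^ c\<close> needs only
  \<open>O(c * log log n)\<close> rounds.\<close>


section \<open>Binary normal form\<close>

abbreviation derives :: "('n, 'a) prods \<Rightarrow> ('n, 'a) symb list \<Rightarrow> ('n, 'a) symb list \<Rightarrow> bool" where
  "derives P \<equiv> (derive1 P)\<^sup>*\<^sup>*"

lemma derive1_context: "derive1 P x y \<Longrightarrow> derive1 P (u @ x @ v) (u @ y @ v)"
proof (induction rule: derive1.induct)
  case (1 A \<alpha> u' v')
  then show ?case
    using derive1.intros[of A \<alpha> P "u @ u'" "v' @ v"] by simp
qed

lemma derives_context: "derives P x y \<Longrightarrow> derives P (u @ x @ v) (u @ y @ v)"
  by (induction rule: rtranclp_induct) (auto intro: rtranclp.rtrancl_into_rtrancl derive1_context)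

lemma derives_append:
  assumes "derives P x x'" "derives P y y'"
  shows "derives P (x @ y) (x' @ y')"
  using derives_context[OF assms(1), of "[]" y] derives_context[OF assms(2), of x' "[]"]
  by (auto intro: rtranclp_trans)

lemma derives_production: "(A, \<alpha>) \<in> P \<Longrightarrow> derives P [Nt A] \<alpha>"
  using derive1.intros[of A \<alpha> P "[]" "[]"] by auto

text \<open>Parse forests in big-step form: the subword below each symbol is explicit, whereas a
  derivation sequence interleaves steps at unrelated places.\<close>

inductive yields :: "('n, 'a) prods \<Rightarrow> ('n, 'a) symb list \<Rightarrow> 'a list \<Rightarrow> bool" for P where
  yields_Nil: "yields P [] []"
| yields_Tm: "yields P \<beta> v \<Longrightarrow> yields P (Tm a # \<beta>) (a # v)"
| yields_Nt: "(A, \<alpha>) \<in> P \<Longrightarrow> yields P \<alpha> u \<Longrightarrow> yields P \<beta> v \<Longrightarrow> yields P (Nt A # \<beta>) (u @ v)"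

lemma yields_map_Tm: "yields P (map Tm w) w"
  by (induction w) (auto intro: yields.intros)

lemma yields_imp_derives: "yields P \<alpha> w \<Longrightarrow> derives P \<alpha> (map Tm w)"
proof (induction rule: yields.induct)
  case (yields_Tm \<beta> v a)
  then show ?case
    using derives_append[of P "[Tm a]" "[Tm a]" \<beta> "map Tm v"] by simp
next
  case (yields_Nt A \<alpha> u \<beta> v)
  then show ?case
    using derives_append[OF rtranclp_trans[OF derives_production], of A \<alpha> P "map Tm u" \<beta> "map Tm v"]
    by simp
qed simp

lemma yields_append:
  "yields P \<alpha> u \<Longrightarrow> yields P \<beta> v \<Longrightarrow> yields P (\<alpha> @ \<beta>) (u @ v)"
proof (induction rule: yields.induct)
  case (yields_Nt A \<alpha> u \<beta>' v')
  then show ?case using yields.yields_Nt[of A \<alpha> P u "\<beta>' @ \<beta>" "v' @ v"] by simp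
qed (auto intro: yields.intros)

lemma yields_appendE:
  "yields P (\<alpha> @ \<beta>) w \<Longrightarrow> \<exists>u v. w = u @ v \<and> yields P \<alpha> u \<and> yields P \<beta> v"
proof (induction \<alpha> arbitrary: w)
  case Nil
  then show ?case by (auto intro: yields_Nil)
next
  case (Cons x \<alpha>)
  from Cons.prems have "yields P (x # \<alpha> @ \<beta>) w" by simp
  then show ?case
  proof cases
    case (yields_Tm v a)
    from Cons.IH[OF yields_Tm(3)] obtain u1 u2
      where "v = u1 @ u2" "yields P \<alpha> u1" "yields P \<beta> u2" by blast
    with yields_Tm show ?thesis
      by (intro exI[of _ "a # u1"] exI[of _ u2]) (auto intro: yields.intros)
  next
    case (yields_Nt A \<gamma> u v)
    from Cons.IH[OF yields_Nt(5)] obtain u1 u2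
      where "v = u1 @ u2" "yields P \<alpha> u1" "yields P \<beta> u2" by blast
    with yields_Nt show ?thesis
      by (intro exI[of _ "u @ u1"] exI[of _ u2]) (auto intro: yields.intros)
  qed
qed

text \<open>Read backwards, a derivation step puts a common new root \<open>A\<close> above the
  trees of \<alpha>. Iterated from the terminal word upwards, this turns a derivation into a
  forest.\<close>

lemma yields_derive1: "derive1 P \<alpha> \<beta> \<Longrightarrow> yields P \<beta> w \<Longrightarrow> yields P \<alpha> w"
proof (induction rule: derive1.induct)
  case (1 A \<alpha> u v)
  then obtain x y z where "w = x @ y @ z" "yields P u x" "yields P \<alpha> y" "yields P v z"
    by (metis yields_appendE)
  with 1(1) show ?case
    by (auto intro!: yields_append yields_Nt)
qed

lemma derives_iff_yields: "derives P \<alpha> (map Tm w) \<longleftrightarrow> yields P \<alpha> w"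
proof
  show "yields P \<alpha> w" if "derives P \<alpha> (map Tm w)"
    using that
    by (induction rule: converse_rtranclp_induct) (auto intro: yields_map_Tm yields_derive1)
qed (rule yields_imp_derives)

section \<open>The normal form grammar and its agreement with the original one\<close>

inductive generates :: "('x \<times> 'x \<times> 'x) set \<Rightarrow> ('x \<Rightarrow> 'a \<Rightarrow> bool) \<Rightarrow> 'x \<Rightarrow> 'a list \<Rightarrow> bool"
  for B T where
  generates_leaf: "T X a \<Longrightarrow> generates B T X [a]"
| generates_node: "(X, Y, Z) \<in> B \<Longrightarrow> generates B T Y u \<Longrightarrow> generates B T Z v \<Longrightarrow>
    generates B T X (u @ v)"

lemma generates_nonempty: "generates B T X w \<Longrightarrow> w \<noteq> []"
  by (induction rule: generates.induct) auto

text \<open>Rules of the normal form are read off full derivability between sentential forms, which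
  absorbs the \<open>\<epsilon>\<close>-productions and unit productions of the grammar.\<close>

definition nf_bin ::
  "('n, 'a) prods \<Rightarrow> ('n, 'a) symb list set \<Rightarrow>
    (('n, 'a) symb list \<times> ('n, 'a) symb list \<times> ('n, 'a) symb list) set" where
  "nf_bin P F = {(\<alpha>, \<beta>, \<gamma>). \<alpha> \<in> F \<and> \<beta> \<in> F \<and> \<gamma> \<in> F \<and> derives P \<alpha> (\<beta> @ \<gamma>)}"

definition nf_leaf :: "('n, 'a) prods \<Rightarrow> ('n, 'a) symb list \<Rightarrow> 'a \<Rightarrow> bool" where
  "nf_leaf P \<alpha> a \<longleftrightarrow> derives P \<alpha> [Tm a]"

lemma generates_imp_derives:
  "generates (nf_bin P F) (nf_leaf P) \<alpha> w \<Longrightarrow> derives P \<alpha> (map Tm w)"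
proof (induction rule: generates.induct)
  case (generates_node X Y Z u v)
  then have "derives P (Y @ Z) (map Tm u @ map Tm v)" by (intro derives_append)
  with generates_node show ?case by (auto simp: nf_bin_def)
qed (simp add: nf_leaf_def)

text \<open>Only the rule at the root has to change, because the rules are closed under prefixing a
  derivation. This is how unit steps and erased symbols disappear.\<close>

lemma generates_derives:
  assumes "generates (nf_bin P F) (nf_leaf P) \<beta> w" "derives P \<alpha> \<beta>" "\<alpha> \<in> F"
  shows "generates (nf_bin P F) (nf_leaf P) \<alpha> w"
  using assms(1)
proof cases
  case (generates_leaf a)
  with assms show ?thesis by (auto simp: nf_leaf_def intro!: generates.generates_leaf)
next
  case (generates_node Y Z u v)
  with assms have "(\<alpha>, Y, Z) \<in> nf_bin P F" by (auto simp: nf_bin_def)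
  with generates_node show ?thesis by (auto intro: generates.generates_node)
qed

text \<open>Induction on the forest, splitting off the first symbol. If both parts carry letters,
  the split is a binary rule. If one part is empty, it is erased by a derivation, and the rest is a
  leaf or is handled by \<open>generates_derives\<close>. Closure of \<open>F\<close> under head,
  tail and right-hand sides keeps all forms met inside \<open>F\<close>.\<close>

lemma yields_imp_generates:
  assumes F: "\<And>x \<beta>. x # \<beta> \<in> F \<Longrightarrow> [x] \<in> F \<and> \<beta> \<in> F"
    and P: "\<And>A \<alpha>. (A, \<alpha>) \<in> P \<Longrightarrow> \<alpha> \<in> F"
  shows "yields P \<alpha> w \<Longrightarrow> \<alpha> \<in> F \<Longrightarrow> w \<noteq> [] \<Longrightarrow> generates (nf_bin P F) (nf_leaf P) \<alpha> w"
proof (induction rule: yields.induct)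
  case (yields_Tm \<beta> v a)
  note mem = F[OF yields_Tm.prems(1)]
  have Tm: "generates (nf_bin P F) (nf_leaf P) [Tm a] [a]"
    by (rule generates_leaf) (simp add: nf_leaf_def)
  show ?case
  proof (cases "v = []")
    case True
    with yields_imp_derives[OF yields_Tm.hyps] derives_append[of P "[Tm a]" "[Tm a]" \<beta> "[]"]
    have "derives P (Tm a # \<beta>) [Tm a]" by simp
    with True show ?thesis by (auto simp: nf_leaf_def intro: generates_leaf)
  next
    case False
    with yields_Tm mem have "generates (nf_bin P F) (nf_leaf P) \<beta> v" by simp
    moreover have "(Tm a # \<beta>, [Tm a], \<beta>) \<in> nf_bin P F"
      using mem yields_Tm.prems by (simp add: nf_bin_def)
    ultimately show ?thesis using generates_node[OF _ Tm] by fastforce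
  qed
next
  case (yields_Nt A \<alpha> u \<beta> v)
  note mem = F[OF yields_Nt.prems(1)] P[OF yields_Nt.hyps(1)]
  note A = derives_production[OF yields_Nt.hyps(1)]
  consider "u = []" | "v = []" "u \<noteq> []" | "u \<noteq> []" "v \<noteq> []" by blast
  then show ?case
  proof cases
    case 1
    with yields_imp_derives[OF yields_Nt.hyps(2)] A have "derives P [Nt A] []" by auto
    then have "derives P (Nt A # \<beta>) \<beta>" using derives_append[of P "[Nt A]" "[]" \<beta> \<beta>] by simp
    with 1 yields_Nt mem show ?thesis by (auto intro: generates_derives)
  next
    case 2
    with yields_imp_derives[OF yields_Nt.hyps(3)] derives_append[OF A, of \<beta> "[]"]
    have "derives P (Nt A # \<beta>) \<alpha>" by simp
    with 2 yields_Nt mem show ?thesis by (auto intro: generates_derives)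
  next
    case 3
    with yields_Nt mem have "generates (nf_bin P F) (nf_leaf P) \<alpha> u" by simp
    from generates_derives[OF this A] mem
    have "generates (nf_bin P F) (nf_leaf P) [Nt A] u" by simp
    moreover from 3 yields_Nt mem have "generates (nf_bin P F) (nf_leaf P) \<beta> v" by simp
    moreover have "(Nt A # \<beta>, [Nt A], \<beta>) \<in> nf_bin P F"
      using mem yields_Nt.prems by (simp add: nf_bin_def)
    ultimately show ?thesis by (auto intro: generates_node)
  qed
qed simp

text \<open>Trees of the normal form have nonempty yield, so \<open>[]\<close> is excluded here; the
  program carries its membership as a separate flag.\<close>

lemma context_free_normal_form:
  fixes L :: "'a::finite list set"
  assumes "context_free L"
  obtains V :: "(nat, 'a) symb list set" and B T S
  where "finite V" "B \<subseteq> V \<times> V \<times> V" "S \<in> V"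
    "\<And>w. w \<noteq> [] \<Longrightarrow> w \<in> L \<longleftrightarrow> generates B T S w"
proof -
  from assms obtain P :: "(nat, 'a) prods" and S where P: "finite P" and L: "L = lang P S"
    by (auto simp: context_free_def)
  \<comment> \<open>All suffixes and all single symbols of right-hand sides, the start form, and
    \<open>[]\<close> as the tail of a one-symbol form. The suffix with k = 0 is the full right-hand
    side.\<close>
  define F :: "(nat, 'a) symb list set" where
    "F = {[Nt S], []} \<union> (\<Union>(A, \<alpha>) \<in> P. (\<lambda>k. drop k \<alpha>) ` {..length \<alpha>} \<union> (\<lambda>x. [x]) ` set \<alpha>)"
  have fin: "finite F" using P by (auto simp: F_def)
  have P_F: "\<alpha> \<in> F" if "(A, \<alpha>) \<in> P" for A \<alpha>
    using that unfolding F_def by (force intro!: image_eqI[where x = 0])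
  have closed: "[x] \<in> F \<and> \<beta> \<in> F" if "x # \<beta> \<in> F" for x \<beta>
  proof -
    from that consider "x = Nt S" "\<beta> = []"
      | A \<alpha> k where "(A, \<alpha>) \<in> P" "x # \<beta> = drop k \<alpha>"
      | A \<alpha> where "(A, \<alpha>) \<in> P" "x \<in> set \<alpha>" "\<beta> = []"
      unfolding F_def by auto
    then show ?thesis
    proof cases
      case (2 A \<alpha> k)
      then have "k < length \<alpha>" by (metis drop_all not_le list.distinct(1))
      with 2 have "x = \<alpha> ! k" "\<beta> = drop (Suc k) \<alpha>" by (simp_all flip: Cons_nth_drop_Suc)
      with \<open>k < length \<alpha>\<close> have "x \<in> set \<alpha>" "\<beta> \<in> (\<lambda>k. drop k \<alpha>) ` {..length \<alpha>}" by auto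
      with 2(1) show ?thesis unfolding F_def by blast
    qed (auto simp: F_def)
  qed
  have "w \<in> L \<longleftrightarrow> generates (nf_bin P F) (nf_leaf P) [Nt S] w" if "w \<noteq> []" for w
  proof -
    have "w \<in> L \<longleftrightarrow> derives P [Nt S] (map Tm w)" by (simp add: L lang_def)
    moreover have "[Nt S] \<in> F" by (simp add: F_def)
    ultimately show ?thesis
      using yields_imp_generates[of F P "[Nt S]" w] closed P_F generates_imp_derives that
      unfolding derives_iff_yields[symmetric] by blast
  qed
  moreover have "nf_bin P F \<subseteq> F \<times> F \<times> F" by (auto simp: nf_bin_def)
  moreover have "[Nt S] \<in> F" by (simp add: F_def)
  ultimately show ?thesis using fin by (intro that[of F "nf_bin P F" "[Nt S]" "nf_leaf P"])
qed


section \<open>Formulas and enumerations\<close>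

definition enum :: "'b set \<Rightarrow> 'b list" where
  "enum A = (SOME xs. set xs = A)"

lemma set_enum: "finite A \<Longrightarrow> set (enum A) = A"
  unfolding enum_def by (rule someI_ex) (rule finite_list)

text \<open>The list chosen by \<open>enum\<close> may repeat elements, so one position of x is
  fixed; distinct elements still get distinct positions.\<close>

definition index :: "'b list \<Rightarrow> 'b \<Rightarrow> nat" where
  "index xs x = (SOME i. i < length xs \<and> xs ! i = x)"

lemma index_less_nth: "x \<in> set xs \<Longrightarrow> index xs x < length xs \<and> xs ! index xs x = x"
  unfolding index_def by (rule someI_ex) (simp add: in_set_conv_nth)

text \<open>False in every structure, including the one with empty domain.\<close>

definition Falsum :: "'r fo" where
  "Falsum = Ex 0 (Neg (Eq 0 0))"

definition Disjs :: "'b set \<Rightarrow> ('b \<Rightarrow> 'r fo) \<Rightarrow> 'r fo" where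
  "Disjs A f = foldr (\<lambda>x. Disj (f x)) (enum A) Falsum"

definition Between :: "nat \<Rightarrow> nat \<Rightarrow> nat \<Rightarrow> 'r fo" where
  "Between x y z = Conj (Le x y) (Le y z)"

text \<open>The successor relation expressed by the order alone; z is a scratch variable for the
  bound quantifier and must differ from x and y.\<close>

definition Succ :: "nat \<Rightarrow> nat \<Rightarrow> nat \<Rightarrow> 'r fo" where
  "Succ z x y = Conj (Neg (Le y x)) (All z (Disj (Le z x) (Le y z)))"

lemma sat_Falsum [simp]: "\<not> sat n I s Falsum"
  by (simp add: Falsum_def)

lemma wf_Falsum [simp]: "wf_fo ar U Falsum"
  by (simp add: Falsum_def)

lemma sat_Disjs [simp]:
  assumes "finite A"
  shows "sat n I s (Disjs A f) \<longleftrightarrow> (\<exists>x \<in> A. sat n I s (f x))"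
proof -
  have "sat n I s (foldr (\<lambda>x. Disj (f x)) xs Falsum) \<longleftrightarrow> (\<exists>x \<in> set xs. sat n I s (f x))" for xs
    by (induction xs) auto
  with assms show ?thesis by (simp add: Disjs_def set_enum)
qed

lemma wf_Disjs [simp]:
  assumes "finite A"
  shows "wf_fo ar U (Disjs A f) \<longleftrightarrow> (\<forall>x \<in> A. wf_fo ar U (f x))"
proof -
  have "wf_fo ar U (foldr (\<lambda>x. Disj (f x)) xs Falsum) \<longleftrightarrow> (\<forall>x \<in> set xs. wf_fo ar U (f x))" for xs
    by (induction xs) auto
  with assms show ?thesis by (simp add: Disjs_def set_enum)
qed

lemma sat_Between [simp]: "sat n I s (Between x y z) \<longleftrightarrow> s x \<le> s y \<and> s y \<le> s z"
  by (simp add: Between_def)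

lemma wf_Between [simp]: "wf_fo ar U (Between x y z) \<longleftrightarrow> {x, y, z} \<subseteq> U"
  by (auto simp: Between_def)

lemma sat_Succ [simp]:
  assumes "z \<noteq> x" "z \<noteq> y" "s y < n"
  shows "sat n I s (Succ z x y) \<longleftrightarrow> s y = Suc (s x)"
proof -
  have "sat n I s (Succ z x y) \<longleftrightarrow> s x < s y \<and> (\<forall>a<n. a \<le> s x \<or> s y \<le> a)"
    using assms by (auto simp: Succ_def)
  \<comment> \<open>Since \<open>s x < s y < n\<close>, the number \<open>Suc (s x)\<close> lies in
    the domain and may instantiate the quantifier.\<close>
  moreover have "s y = Suc (s x)" if "s x < s y" "\<forall>a<n. a \<le> s x \<or> s y \<le> a"
    using that(1) assms(3) that(2)[rule_format, of "Suc (s x)"] by linarith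
  ultimately show ?thesis by (metis Suc_le_eq lessI not_le)
qed

lemma wf_Succ [simp]: "z \<noteq> x \<Longrightarrow> z \<noteq> y \<Longrightarrow> wf_fo ar U (Succ z x y) \<longleftrightarrow> {x, y} \<subseteq> U"
  by (auto simp: Succ_def)

section \<open>Intervals of positions\<close>

lemma upt_split: "i \<le> m \<Longrightarrow> m \<le> j \<Longrightarrow> [i..<j] = [i..<m] @ [m..<j]"
  using upt_add_eq_append[of i m "j - m"] by simp

text \<open>Lifts a cut of the word to a cut of the list of positions carrying it. This locates the
  boundary between the two subtrees of a node.\<close>

lemma map_filter_eq_append:
  "List.map_filter f xs = u @ v \<Longrightarrow>
   \<exists>ys zs. xs = ys @ zs \<and> List.map_filter f ys = u \<and> List.map_filter f zs = v"
proof (induction xs arbitrary: u)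
  case (Cons x xs)
  show ?case
  proof (cases "f x")
    case None
    with Cons.prems have "List.map_filter f xs = u @ v" by simp
    with Cons.IH obtain ys zs
      where "xs = ys @ zs" "List.map_filter f ys = u" "List.map_filter f zs = v" by blast
    with None show ?thesis by (intro exI[of _ "x # ys"] exI[of _ zs]) simp
  next
    case (Some y)
    show ?thesis
    proof (cases u)
      case Nil
      with Cons.prems show ?thesis by (intro exI[of _ "[]"] exI[of _ "x # xs"]) simp
    next
      case (Cons z u')
      with Cons.prems Some have "List.map_filter f xs = u' @ v" "z = y" by auto
      with Cons.IH obtain ys zs
        where "xs = ys @ zs" "List.map_filter f ys = u'" "List.map_filter f zs = v" by blast
      with Some Cons \<open>z = y\<close> show ?thesis by (intro exI[of _ "x # ys"] exI[of _ zs]) simp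
    qed
  qed
qed simp

lemma map_filter_eq_single:
  "List.map_filter f xs = [a] \<Longrightarrow> distinct xs \<Longrightarrow>
   \<exists>p \<in> set xs. f p = Some a \<and> (\<forall>r \<in> set xs. r \<noteq> p \<longrightarrow> f r = None)"
proof (induction xs)
  case (Cons x xs)
  show ?case
  proof (cases "f x")
    case (Some y)
    with Cons.prems have "y = a" "List.map_filter f xs = []" by auto
    then have "\<forall>r \<in> set xs. f r = None" by (auto simp: List.map_filter_def filter_empty_conv)
    with Some \<open>y = a\<close> show ?thesis by auto
  qed (use Cons in auto)
qed simp

lemma word_of_eq:
  fixes w :: "'a input"
  shows "word_of w = List.map_filter ((!) w) [0..<length w]"
proof -
  have "List.map_filter id (map g xs) = List.map_filter g xs" for g :: "nat \<Rightarrow> 'a option" and xs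
    by (induction xs) (auto split: option.split)
  from this[of "(!) w" "[0..<length w]"] show ?thesis by (simp add: word_of_def map_nth)
qed

lemma word_of_eq_Nil: "word_of w = [] \<longleftrightarrow> (\<forall>r<length w. w ! r = None)"
  by (auto simp: word_of_eq List.map_filter_def filter_empty_conv)

lemma card_atLeastAtMost_split:
  assumes "finite C" "i \<le> m" "m \<le> j"
  shows "card (C \<inter> {i..j}) = card (C \<inter> {i..m}) + card (C \<inter> {Suc m..j})"
proof -
  have "C \<inter> {i..j} = (C \<inter> {i..m}) \<union> (C \<inter> {Suc m..j})" using assms by auto
  then show ?thesis using assms by (simp add: card_Un_disjoint disjoint_iff)
qed

lemma card_interval_mono:
  "finite C \<Longrightarrow> (k::nat) \<le> i \<Longrightarrow> j \<le> l \<Longrightarrow> card (C \<inter> {i..j}) \<le> card (C \<inter> {k..l})"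
  by (intro card_mono) auto


section \<open>Spans and gaps\<close>

text \<open>A position carries no letter iff \<open>f\<close> is \<open>None\<close> there. All intervals are closed and nonempty,
  since the position after the last one is not an element of the domain.\<close>

locale normal_form =
  fixes V :: "'x set" and B :: "('x \<times> 'x \<times> 'x) set" and T :: "'x \<Rightarrow> 'a::finite \<Rightarrow> bool" and S :: 'x
  assumes finite_V: "finite V" and B_subset: "B \<subseteq> V \<times> V \<times> V" and S_V: "S \<in> V"
begin

definition leaf :: "(nat \<Rightarrow> 'a option) \<Rightarrow> 'x \<Rightarrow> nat \<Rightarrow> nat \<Rightarrow> bool" where
  "leaf f X i j \<longleftrightarrow>
     (\<exists>p a. i \<le> p \<and> p \<le> j \<and> f p = Some a \<and> T X a \<and> (\<forall>r. i \<le> r \<and> r \<le> j \<and> r \<noteq> p \<longrightarrow> f r = None))"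

text \<open>The trivial context: the two intervals differ by letterless positions only. Sibling
  intervals have to be adjacent, so each letterless position must be absorbed by some neighbouring
  interval.\<close>

definition pad :: "(nat \<Rightarrow> 'a option) \<Rightarrow> nat \<Rightarrow> nat \<Rightarrow> nat \<Rightarrow> nat \<Rightarrow> bool" where
  "pad f i j p q \<longleftrightarrow>
     i \<le> p \<and> p \<le> q \<and> q \<le> j \<and> (\<forall>r. i \<le> r \<and> r \<le> j \<and> \<not> (p \<le> r \<and> r \<le> q) \<longrightarrow> f r = None)"

inductive span :: "(nat \<Rightarrow> 'a option) \<Rightarrow> 'x \<Rightarrow> nat \<Rightarrow> nat \<Rightarrow> bool" for f where
  span_leaf: "leaf f X i j \<Longrightarrow> span f X i j"
| span_node: "(X, Y, Z) \<in> B \<Longrightarrow> span f Y i m \<Longrightarrow> span f Z (Suc m) j \<Longrightarrow> span f X i j"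

text \<open>\<open>gap f X W i j p q\<close>: \<open>X\<close> derives the word on \<open>{i..j}\<close> with the factor on \<open>{p..q}\<close> replaced
  by the nonterminal \<open>W\<close>.\<close>

inductive gap ::
  "(nat \<Rightarrow> 'a option) \<Rightarrow> 'x \<Rightarrow> 'x \<Rightarrow> nat \<Rightarrow> nat \<Rightarrow> nat \<Rightarrow> nat \<Rightarrow> bool" for f where
  gap_pad: "pad f i j p q \<Longrightarrow> gap f X X i j p q"
| gap_right: "(X, Y, Z) \<in> B \<Longrightarrow> span f Y i m \<Longrightarrow> gap f Z W (Suc m) j p q \<Longrightarrow> gap f X W i j p q"
| gap_left: "(X, Y, Z) \<in> B \<Longrightarrow> gap f Y W i m p q \<Longrightarrow> span f Z (Suc m) j \<Longrightarrow> gap f X W i j p q"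

section \<open>Padding, composition and locality of spans and gaps\<close>

lemma span_le: "span f X i j \<Longrightarrow> i \<le> j"
  by (induction rule: span.induct) (auto simp: leaf_def)

lemma gap_le: "gap f X W i j p q \<Longrightarrow> i \<le> p \<and> p \<le> q \<and> q \<le> j"
  by (induction rule: gap.induct) (auto simp: pad_def dest: span_le)

lemma gap_refl: "i \<le> j \<Longrightarrow> gap f X X i j i j"
  by (rule gap_pad) (auto simp: pad_def)

lemma gap_V: "gap f X W i j p q \<Longrightarrow> X \<in> V \<Longrightarrow> W \<in> V"
  by (induction rule: gap.induct) (use B_subset in auto)

text \<open>The cut of a node stays in place: the left child absorbs the blanks on the left and the
  right child those on the right, down to the outermost leaves.\<close>

lemma span_pad: "span f X p q \<Longrightarrow> pad f i j p q \<Longrightarrow> span f X i j"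
proof (induction arbitrary: i j rule: span.induct)
  case (span_leaf X p q)
  then obtain k a where "p \<le> k" "k \<le> q" "f k = Some a" "T X a"
    "\<forall>r. p \<le> r \<and> r \<le> q \<and> r \<noteq> k \<longrightarrow> f r = None"
    by (auto simp: leaf_def)
  moreover from span_leaf.prems this have "i \<le> k" "k \<le> j"
    "\<forall>r. i \<le> r \<and> r \<le> j \<and> r \<noteq> k \<longrightarrow> f r = None"
    by (auto simp: pad_def)
  ultimately have "leaf f X i j" unfolding leaf_def by blast
  then show ?case by (rule span.span_leaf)
next
  case (span_node X Y Z p m q)
  note le = span_le[OF span_node.hyps(2)] span_le[OF span_node.hyps(3)]
  have "pad f i m p m" "pad f (Suc m) j (Suc m) q"
    using span_node.prems le by (auto simp: pad_def)
  with span_node show ?case by (blast intro: span.span_node)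
qed

lemma gap_outer_pad: "gap f X W k l p q \<Longrightarrow> pad f i j k l \<Longrightarrow> gap f X W i j p q"
proof (induction arbitrary: i j rule: gap.induct)
  case (gap_pad k l p q X)
  have "pad f i j p q"
    using gap_pad unfolding pad_def by (meson order_trans)
  then show ?case by (rule gap.gap_pad)
next
  case (gap_right X Y Z k m W l p q)
  note le = span_le[OF gap_right.hyps(2)] gap_le[OF gap_right.hyps(3)]
  have "pad f i m k m" "pad f (Suc m) j (Suc m) l"
    using gap_right.prems le by (auto simp: pad_def)
  with gap_right show ?case by (blast intro: gap.gap_right span_pad)
next
  case (gap_left X Y Z W k m p q l)
  note le = span_le[OF gap_left.hyps(3)] gap_le[OF gap_left.hyps(2)]
  have "pad f i m k m" "pad f (Suc m) j (Suc m) l"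
    using gap_left.prems le by (auto simp: pad_def)
  with gap_left show ?case by (blast intro: gap.gap_left span_pad)
qed

lemma gap_span: "gap f X W i j p q \<Longrightarrow> span f W p q \<Longrightarrow> span f X i j"
  by (induction rule: gap.induct) (auto intro: span_pad span_node)

text \<open>Composition of contexts, by induction on the outer one; its base case is mere padding,
  hence \<open>gap_outer_pad\<close>.\<close>

lemma gap_trans: "gap f X Z i j k l \<Longrightarrow> gap f Z W k l p q \<Longrightarrow> gap f X W i j p q"
  by (induction rule: gap.induct) (auto intro: gap_outer_pad gap_right gap_left)

lemma span_cong:
  "span f X i j \<Longrightarrow> (\<And>r. i \<le> r \<Longrightarrow> r \<le> j \<Longrightarrow> f r = g r) \<Longrightarrow> span g X i j"
proof (induction rule: span.induct)
  case (span_leaf X i j)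
  then have "leaf g X i j" unfolding leaf_def by fastforce
  then show ?case by (rule span.span_leaf)
next
  case (span_node X Y Z i m j)
  note le = span_le[OF span_node.hyps(2)] span_le[OF span_node.hyps(3)]
  with span_node have "span g Y i m" "span g Z (Suc m) j" by auto
  with span_node show ?case by (blast intro: span.span_node)
qed

text \<open>A gap does not depend on the letters in its hole \<open>{p..q}\<close>. Hence only
  changes in \<open>{i..j}\<close> outside \<open>{p..q}\<close> count as changes of a gap.\<close>

lemma gap_cong:
  "gap f X W i j p q \<Longrightarrow> (\<And>r. i \<le> r \<Longrightarrow> r \<le> j \<Longrightarrow> \<not> (p \<le> r \<and> r \<le> q) \<Longrightarrow> f r = g r) \<Longrightarrow>
   gap g X W i j p q"
proof (induction rule: gap.induct)
  case (gap_pad i j p q X)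
  then have "pad g i j p q" unfolding pad_def by auto
  then show ?case by (rule gap.gap_pad)
next
  case (gap_right X Y Z i m W j p q)
  note le = span_le[OF gap_right.hyps(2)] gap_le[OF gap_right.hyps(3)]
  have "span g Y i m" using le by (intro span_cong[OF gap_right.hyps(2)] gap_right.prems) auto
  moreover have "gap g Z W (Suc m) j p q" using gap_right le by auto
  ultimately show ?case using gap_right by (blast intro: gap.gap_right)
next
  case (gap_left X Y Z W i m p q j)
  note le = span_le[OF gap_left.hyps(3)] gap_le[OF gap_left.hyps(2)]
  have "span g Z (Suc m) j" using le by (intro span_cong[OF gap_left.hyps(3)] gap_left.prems) auto
  moreover have "gap g Y W i m p q" using gap_left le by auto
  ultimately show ?case using gap_left by (blast intro: gap.gap_left)
qed

section \<open>Spans and the words generated by the normal form\<close>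

lemma span_imp_generates: "span f X i j \<Longrightarrow> generates B T X (List.map_filter f [i..<Suc j])"
proof (induction rule: span.induct)
  case (span_leaf X i j)
  then obtain p a where p: "i \<le> p" "p \<le> j" "f p = Some a" "T X a"
    and none: "\<forall>r. i \<le> r \<and> r \<le> j \<and> r \<noteq> p \<longrightarrow> f r = None"
    by (auto simp: leaf_def)
  have "[i..<Suc j] = [i..<p] @ p # [Suc p..<Suc j]"
    using p upt_split[of i p "Suc j"] upt_conv_Cons[of p "Suc j"] by (simp del: upt_Suc)
  moreover have "List.map_filter f [i..<p] = []" "List.map_filter f [Suc p..<Suc j] = []"
    using p none by (auto simp: List.map_filter_def filter_empty_conv)
  ultimately have "List.map_filter f [i..<Suc j] = [a]"
    using p by (simp add: map_filter_def)
  with p show ?case by (simp add: generates_leaf)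
next
  case (span_node X Y Z i m j)
  note le = span_le[OF span_node.hyps(2)] span_le[OF span_node.hyps(3)]
  then have "[i..<Suc j] = [i..<Suc m] @ [Suc m..<Suc j]"
    by (intro upt_split) auto
  with span_node show ?case by (simp add: map_filter_def generates_node del: upt_Suc)
qed

text \<open>Here k is an exclusive bound, while spans are closed intervals, so the span ends at k -
  1; since the word is nonempty, the interval is too.\<close>

lemma generates_imp_span:
  "generates B T X w \<Longrightarrow> List.map_filter f [i..<k] = w \<Longrightarrow> span f X i (k - 1)"
proof (induction arbitrary: i k rule: generates.induct)
  case (generates_leaf X a)
  then obtain p where "i \<le> p" "p < k" "f p = Some a"
    "\<forall>r. i \<le> r \<and> r < k \<and> r \<noteq> p \<longrightarrow> f r = None"
    using map_filter_eq_single[of f "[i..<k]" a] by auto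
  with generates_leaf have "leaf f X i (k - 1)" unfolding leaf_def
    by (intro exI[of _ p] exI[of _ a]) auto
  then show ?case by (rule span_leaf)
next
  case (generates_node X Y Z u v)
  from map_filter_eq_append[OF generates_node.prems] obtain ys zs
    where ys: "[i..<k] = ys @ zs" "List.map_filter f ys = u" "List.map_filter f zs = v" by blast
  \<comment> \<open>The first position of the right part. The left part ends at m - 1, and
    \<open>ys \<noteq> []\<close> makes m positive, so that \<open>Suc (m - 1) = m\<close>.\<close>
  define m where "m = i + length ys"
  have "ys \<noteq> []" using ys generates_node.hyps generates_nonempty by fastforce
  have len: "length ys + length zs = k - i" using arg_cong[OF ys(1), of length] by simp
  have "ys = take (length ys) [i..<k]" "zs = drop (length ys) [i..<k]" by (simp_all add: ys(1))
  moreover have "i + length ys \<le> k" using len \<open>ys \<noteq> []\<close> by (cases ys) auto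
  ultimately have "ys = [i..<m]" "zs = [m..<k]"
    unfolding m_def by (metis take_upt, metis drop_upt)
  with ys generates_node.IH have "span f Y i (m - 1)" "span f Z m (k - 1)" by auto
  moreover have "Suc (m - 1) = m" using \<open>ys \<noteq> []\<close> by (simp add: m_def)
  ultimately show ?case using generates_node.hyps(1) by (metis span_node)
qed


section \<open>Halving the number of marked positions\<close>

text \<open>The witness is the lowest node of the parse tree below which at least \<open>h\<close> positions of \<open>C\<close>
  occur.\<close>

lemma span_halve:
  assumes C: "finite C"
  shows "span f X i j \<Longrightarrow> h \<le> card (C \<inter> {i..j}) \<Longrightarrow>
    \<exists>A p q. gap f X A i j p q \<and> h \<le> card (C \<inter> {p..q}) \<and>
      (leaf f A p q \<or> (\<exists>Y Z m. (A, Y, Z) \<in> B \<and> span f Y p m \<and> span f Z (Suc m) q \<and>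
        card (C \<inter> {p..m}) < h \<and> card (C \<inter> {Suc m..q}) < h))"
proof (induction rule: span.induct)
  case (span_leaf X i j)
  then have "gap f X X i j i j" by (auto simp: leaf_def intro: gap_refl)
  with span_leaf show ?case by blast
next
  case (span_node X Y Z i m j)
  note le = span_le[OF span_node.hyps(2)] span_le[OF span_node.hyps(3)]
  consider "h \<le> card (C \<inter> {i..m})" | "h \<le> card (C \<inter> {Suc m..j})"
    | "card (C \<inter> {i..m}) < h" "card (C \<inter> {Suc m..j}) < h" by linarith
  then show ?case
  proof cases
    case 1
    with span_node.IH(1) span_node.hyps show ?thesis by (blast intro: gap_left)
  next
    case 2
    with span_node.IH(2) span_node.hyps show ?thesis by (blast intro: gap_right)
  next
    case 3
    from le have "gap f X X i j i j" by (intro gap_refl) simp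
    with 3 span_node.hyps span_node.prems show ?thesis by blast
  qed
qed

text \<open>Follows the path from the root towards the hole as long as the child on the path keeps
  at least h marked positions outside the hole. Where this stops, the child on the path has fewer
  than h of them, but the sibling is not bounded by h. If the path ends at \<open>W\<close> itself,
  only padding remains.\<close>

lemma gap_halve:
  assumes C: "finite C"
  shows "gap f X W i j p q \<Longrightarrow> h \<le> card (C \<inter> {i..j}) - card (C \<inter> {p..q}) \<Longrightarrow>
    \<exists>A k l. gap f X A i j k l \<and> h \<le> card (C \<inter> {k..l}) - card (C \<inter> {p..q}) \<and>
      (A = W \<and> pad f k l p q \<or>
       (\<exists>Y Z m. (A, Y, Z) \<in> B \<and>
         (span f Y k m \<and> gap f Z W (Suc m) l p q \<and>
            card (C \<inter> {Suc m..l}) - card (C \<inter> {p..q}) < h \<or>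
          gap f Y W k m p q \<and> span f Z (Suc m) l \<and>
            card (C \<inter> {k..m}) - card (C \<inter> {p..q}) < h)))"
proof (induction rule: gap.induct)
  case (gap_pad i j p q X)
  then have "gap f X X i j i j" by (auto simp: pad_def intro: gap_refl)
  with gap_pad show ?case by blast
next
  case (gap_right X Y Z i m W j p q)
  note le = span_le[OF gap_right.hyps(2)] gap_le[OF gap_right.hyps(3)]
  show ?case
  proof (cases "h \<le> card (C \<inter> {Suc m..j}) - card (C \<inter> {p..q})")
    case True
    with gap_right.IH gap_right.hyps show ?thesis by (blast intro: gap.gap_right)
  next
    case False
    from le have "gap f X X i j i j" by (intro gap_refl) simp
    with False gap_right.hyps gap_right.prems show ?thesis unfolding not_le by blast
  qed
next
  case (gap_left X Y Z W i m p q j)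
  note le = span_le[OF gap_left.hyps(3)] gap_le[OF gap_left.hyps(2)]
  show ?case
  proof (cases "h \<le> card (C \<inter> {i..m}) - card (C \<inter> {p..q})")
    case True
    with gap_left.IH gap_left.hyps show ?thesis by (blast intro: gap.gap_left)
  next
    case False
    from le have "gap f X X i j i j" by (intro gap_refl) simp
    with False gap_left.hyps gap_left.prems show ?thesis unfolding not_le by blast
  qed
qed

end


section \<open>The dynamic program\<close>

datatype 'x item = Der 'x | Gap 'x 'x

primrec item_arity :: "'x item \<Rightarrow> nat" where
  "item_arity (Der X) = 2"
| "item_arity (Gap X Y) = 4"

text \<open>An update sees only the changed input; \<open>Old a\<close> remembers the previous
  letters, so that formulas can tell which positions changed.\<close>

datatype ('x, 'a) stored = Item "'x item" | Old 'a | Answer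

primrec stored_arity :: "('x, 'a) stored \<Rightarrow> nat" where
  "stored_arity (Item it) = item_arity it"
| "stored_arity (Old a) = 1"
| "stored_arity Answer = 0"

context normal_form
begin

definition items :: "'x item set" where
  "items = Der ` V \<union> case_prod Gap ` (V \<times> V)"

definition stored_rels :: "('x, 'a) stored set" where
  "stored_rels = Item ` items \<union> range Old \<union> {Answer}"

definition work_index :: "'x item \<Rightarrow> nat" where
  "work_index it = index (enum items) it"

definition aux_index :: "('x, 'a) stored \<Rightarrow> nat" where
  "aux_index r = index (enum stored_rels) r"

definition WorkAtom :: "'x item \<Rightarrow> nat list \<Rightarrow> 'a rsym fo" where
  "WorkAtom it = Rel (Work (work_index it))"

definition AuxAtom :: "('x, 'a) stored \<Rightarrow> nat list \<Rightarrow> 'a rsym fo" where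
  "AuxAtom r = Rel (Aux (aux_index r))"

definition Blank :: "nat \<Rightarrow> 'a rsym fo" where
  "Blank x = Neg (Disjs UNIV (\<lambda>a. Rel (Letter a) [x]))"

definition Same :: "nat \<Rightarrow> 'a rsym fo" where
  "Same x = Neg (Disjs UNIV (\<lambda>a.
     Disj (Conj (Rel (Letter a) [x]) (Neg (AuxAtom (Old a) [x])))
          (Conj (AuxAtom (Old a) [x]) (Neg (Rel (Letter a) [x])))))"

text \<open>In \<open>Leaf\<close> and \<open>Pad\<close> the variables named first are scratch
  variables for bound quantifiers, to be chosen apart from the interval ends.\<close>

definition Leaf :: "nat \<Rightarrow> nat \<Rightarrow> 'x \<Rightarrow> nat \<Rightarrow> nat \<Rightarrow> 'a rsym fo" where
  "Leaf p r X i j =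
     Ex p (Conj (Between i p j) (Conj (Disjs {a. T X a} (\<lambda>a. Rel (Letter a) [p]))
       (All r (Disj (Neg (Between i r j)) (Disj (Eq r p) (Blank r))))))"

definition Pad :: "nat \<Rightarrow> nat \<Rightarrow> nat \<Rightarrow> nat \<Rightarrow> nat \<Rightarrow> 'a rsym fo" where
  "Pad r i j p q =
     Conj (Le i p) (Conj (Le p q) (Conj (Le q j)
       (All r (Disj (Neg (Between i r j)) (Disj (Between p r q) (Blank r))))))"

definition rules :: "'x \<Rightarrow> ('x \<times> 'x) set" where
  "rules X = {(Y, Z). (X, Y, Z) \<in> B}"

text \<open>The first disjunct copies a stored fact whose relevant positions are unchanged. The
  second guesses the node \<open>A\<close> at which the tree is cut: variables 2, 3 (for gaps 4, 5)
  hold its interval, the next two hold the end of its left child and the start of its right child,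
  and the last one is scratch for \<open>Succ\<close>.\<close>

primrec step_fo :: "'x item \<Rightarrow> 'a rsym fo" where
  "step_fo (Der X) =
     Disj (Conj (AuxAtom (Item (Der X)) [0, 1]) (All 2 (Disj (Neg (Between 0 2 1)) (Same 2))))
       (Disjs V (\<lambda>A. Ex 2 (Ex 3 (Conj (WorkAtom (Gap X A) [0, 1, 2, 3])
         (Disj (Leaf 4 5 A 2 3)
           (Disjs (rules A) (\<lambda>(Y, Z). Ex 4 (Ex 5 (Conj (Succ 6 4 5)
              (Conj (WorkAtom (Der Y) [2, 4]) (WorkAtom (Der Z) [5, 3])))))))))))"
| "step_fo (Gap X W) =
     Disj (Conj (AuxAtom (Item (Gap X W)) [0, 1, 2, 3])
            (All 4 (Disj (Neg (Between 0 4 1)) (Disj (Between 2 4 3) (Same 4)))))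
       (Disjs V (\<lambda>A. Ex 4 (Ex 5 (Conj (WorkAtom (Gap X A) [0, 1, 4, 5])
         (Disj (if A = W then Pad 6 4 5 2 3 else Falsum)
           (Disjs (rules A) (\<lambda>(Y, Z). Ex 6 (Ex 7 (Conj (Succ 8 6 7)
              (Disj (Conj (WorkAtom (Der Y) [4, 6]) (WorkAtom (Gap Z W) [7, 5, 2, 3]))
                    (Conj (WorkAtom (Gap Y W) [4, 6, 2, 3]) (WorkAtom (Der Z) [7, 5]))))))))))))"

text \<open>A letterless word has no spans, and its gaps are exactly the paddings. The flag e stands
  for \<open>[] \<in> L\<close>.\<close>

primrec init_fo :: "bool \<Rightarrow> ('x, 'a) stored \<Rightarrow> 'a fo" where
  "init_fo e (Item it) = (case it of Der X \<Rightarrow> Falsum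
     | Gap X Y \<Rightarrow> if X = Y then Conj (Between 0 2 3) (Le 3 1) else Falsum)"
| "init_fo e (Old a) = Falsum"
| "init_fo e Answer = (if e then Neg Falsum else Falsum)"

text \<open>For \<open>Answer\<close>, variables 0 and 1 are forced to be the first and last
  position. The empty word, including the case of an empty domain, is decided by the flag e.\<close>

primrec result_fo :: "bool \<Rightarrow> ('x, 'a) stored \<Rightarrow> 'a rsym fo" where
  "result_fo e (Item it) = WorkAtom it [0..<item_arity it]"
| "result_fo e (Old a) = Rel (Letter a) [0]"
| "result_fo e Answer =
     Disj (if e then All 0 (Blank 0) else Falsum)
       (Ex 0 (Ex 1 (Conj (All 2 (Between 0 2 1)) (WorkAtom (Der S) [0, 1]))))"

definition work_defs :: "(nat \<times> 'a rsym fo) list" where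
  "work_defs = map (\<lambda>it. (item_arity it, step_fo it)) (enum items)"

definition program :: "bool \<Rightarrow> nat \<Rightarrow> 'a dynprog" where
  "program e k =
     \<lparr>auxs = map (\<lambda>r. \<lparr>arity = stored_arity r, init = init_fo e r,
        upd = \<lparr>work = work_defs, iters = k, result = result_fo e r\<rparr>\<rparr>) (enum stored_rels),
      answer = aux_index Answer\<rparr>"

section \<open>Finiteness, indices and well-formedness of the program\<close>

lemma finite_items: "finite items"
  using finite_V by (simp add: items_def)

lemma finite_stored_rels: "finite stored_rels"
  using finite_items by (simp add: stored_rels_def)

lemma finite_rules [simp]: "finite (rules X)"
  using finite_subset[of "rules X" "V \<times> V"] finite_V B_subset by (auto simp: rules_def)

lemma rules_V: "(Y, Z) \<in> rules X \<Longrightarrow> Y \<in> V \<and> Z \<in> V"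
  using B_subset by (auto simp: rules_def)

lemma in_items [simp]:
  "Der X \<in> items \<longleftrightarrow> X \<in> V"
  "Gap X Y \<in> items \<longleftrightarrow> X \<in> V \<and> Y \<in> V"
  by (auto simp: items_def)

lemma in_stored_rels [simp]:
  "Item it \<in> stored_rels \<longleftrightarrow> it \<in> items"
  "Old a \<in> stored_rels"
  "Answer \<in> stored_rels"
  by (auto simp: stored_rels_def)

lemma work_index_nth:
  "it \<in> items \<Longrightarrow> work_index it < length (enum items) \<and> enum items ! work_index it = it"
  by (simp add: work_index_def index_less_nth set_enum finite_items)

lemma aux_index_nth:
  "r \<in> stored_rels \<Longrightarrow>
   aux_index r < length (enum stored_rels) \<and> enum stored_rels ! aux_index r = r"
  by (simp add: aux_index_def index_less_nth set_enum finite_stored_rels)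

lemma wf_program: "wf_dynprog (program e k)"
proof -
  define P where "P = program e k"
  let ?v = "\<lambda>g. \<lparr>work = work_defs, iters = k, result = g\<rparr>"
  let ?u = "\<lambda>r. ?v (result_fo e r)"
  have Work: "wf_fo (sig P (?v g)) U (WorkAtom it xs) \<longleftrightarrow> length xs = item_arity it \<and> set xs \<subseteq> U"
    if "it \<in> items" for it xs g U
    using work_index_nth[OF that] by (auto simp: WorkAtom_def work_defs_def)
  have Aux: "wf_fo (sig P (?v g)) U (AuxAtom q xs) \<longleftrightarrow> length xs = stored_arity q \<and> set xs \<subseteq> U"
    if "q \<in> stored_rels" for q xs g U
    using aux_index_nth[OF that] by (auto simp: AuxAtom_def P_def program_def)
  have blank: "wf_fo (sig P (?v g)) U (Blank x) \<longleftrightarrow> x \<in> U" for g U x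
    by (auto simp: Blank_def)
  have same: "wf_fo (sig P (?v g)) U (Same x) \<longleftrightarrow> x \<in> U" for g U x
    by (auto simp: Same_def Aux)
  have "wf_fo (sig P (?v g)) {..<item_arity it} (step_fo it)" if "it \<in> items" for it g
    using that finite_V
    by (cases it) (auto simp: Work Aux blank same Leaf_def Pad_def dest: rules_V)
  moreover have "wf_fo (sig P (?u r)) {..<stored_arity r} (result_fo e r)"
    if "r \<in> stored_rels" for r
    using that S_V by (cases r) (auto simp: Work blank)
  moreover have "wf_fo (\<lambda>_. Some 1) {..<stored_arity r} (init_fo e r)" for r
    by (cases r) (auto split: item.split)
  moreover have "answer P < length (auxs P) \<and> arity (auxs P ! answer P) = 0"
    using aux_index_nth[of Answer] by (simp add: P_def program_def)
  moreover have "set (auxs P) = (\<lambda>r. \<lparr>arity = stored_arity r, init = init_fo e r, upd = ?u r\<rparr>) ` stored_rels"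
    by (simp add: P_def program_def set_enum finite_stored_rels)
  moreover have "set work_defs = (\<lambda>it. (item_arity it, step_fo it)) ` items"
    by (simp add: work_defs_def set_enum finite_items)
  ultimately show ?thesis
    unfolding wf_dynprog_def P_def[symmetric] by auto
qed


section \<open>One round of the update\<close>

text \<open>The bound \<open>j < length w\<close> is explicit because list access beyond the end has
  no specified value. The clause on \<open>Old\<close> is what makes \<open>Same\<close> detect the
  changes.\<close>

definition invariant :: "'a list set \<Rightarrow> 'a input \<Rightarrow> (nat \<Rightarrow> nat list set) \<Rightarrow> bool" where
  "invariant L w A \<longleftrightarrow>
     (\<forall>X \<in> V. \<forall>i j. [i, j] \<in> A (aux_index (Item (Der X))) \<longleftrightarrow> j < length w \<and> span ((!) w) X i j) \<and>
     (\<forall>X \<in> V. \<forall>Y \<in> V. \<forall>i j p q. [i, j, p, q] \<in> A (aux_index (Item (Gap X Y))) \<longleftrightarrow>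
        j < length w \<and> gap ((!) w) X Y i j p q) \<and>
     (\<forall>a p. [p] \<in> A (aux_index (Old a)) \<longleftrightarrow> p < length w \<and> w ! p = Some a) \<and>
     ([] \<in> A (aux_index Answer) \<longleftrightarrow> word_of w \<in> L)"

lemma sat_WorkAtom [simp]:
  "sat n (interp w A W) s (WorkAtom it xs) \<longleftrightarrow> map s xs \<in> W (work_index it)"
  by (simp add: WorkAtom_def)

lemma sat_AuxAtom [simp]:
  "sat n (interp w A W) s (AuxAtom r xs) \<longleftrightarrow> map s xs \<in> A (aux_index r)"
  by (simp add: AuxAtom_def)

lemma sat_Blank [simp]:
  "s x < length w \<Longrightarrow> sat n (interp w A W) s (Blank x) \<longleftrightarrow> w ! s x = None"
  by (cases "w ! s x") (auto simp: Blank_def letter_rel_def)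

lemma sat_Same [simp]:
  assumes "invariant L w A" "length w' = length w" "s x < length w'"
  shows "sat n (interp w' A W) s (Same x) \<longleftrightarrow> w ! s x = w' ! s x"
proof -
  have "[s x] \<in> A (aux_index (Old a)) \<longleftrightarrow> w ! s x = Some a" for a
    using assms by (simp add: invariant_def)
  moreover have "[s x] \<in> letter_rel w' a \<longleftrightarrow> w' ! s x = Some a" for a
    using assms by (simp add: letter_rel_def)
  ultimately have "sat n (interp w' A W) s (Same x) \<longleftrightarrow>
      (\<forall>a. w ! s x = Some a \<longleftrightarrow> w' ! s x = Some a)"
    by (auto simp: Same_def)
  then show ?thesis by (cases "w ! s x"; cases "w' ! s x") auto
qed

lemma sat_Leaf [simp]:
  assumes "distinct [p, r, i, j]" "s j < length w"
  shows "sat (length w) (interp w A W) s (Leaf p r X i j) \<longleftrightarrow> leaf ((!) w) X (s i) (s j)"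
proof -
  have "sat (length w) (interp w A W) s (Leaf p r X i j) \<longleftrightarrow>
      (\<exists>k<length w. s i \<le> k \<and> k \<le> s j \<and> k < length w \<and> (\<exists>a. T X a \<and> w ! k = Some a) \<and>
        (\<forall>l<length w. s i \<le> l \<longrightarrow> l \<le> s j \<longrightarrow> l = k \<or> w ! l = None))"
    using assms(1) by (simp add: Leaf_def letter_rel_def)
  with assms(2) show ?thesis unfolding leaf_def by (meson le_less_trans)
qed

lemma sat_Pad [simp]:
  assumes "r \<notin> {i, j, p, q}" "s j < length w"
  shows "sat (length w) (interp w A W) s (Pad r i j p q) \<longleftrightarrow> pad ((!) w) (s i) (s j) (s p) (s q)"
proof -
  have "sat (length w) (interp w A W) s (Pad r i j p q) \<longleftrightarrow>
      s i \<le> s p \<and> s p \<le> s q \<and> s q \<le> s j \<and>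
      (\<forall>l<length w. s i \<le> l \<longrightarrow> l \<le> s j \<longrightarrow> s p \<le> l \<and> l \<le> s q \<or> w ! l = None)"
    using assms(1) by (simp add: Pad_def)
  with assms(2) show ?thesis unfolding pad_def by (meson le_less_trans)
qed

lemma work_step_eq:
  assumes "work u = work_defs" "it \<in> items"
  shows "work_step u w A W (work_index it) =
    defrel (length w) (interp w A W) (item_arity it) (step_fo it)"
  using work_index_nth[OF assms(2)] assms(1) by (simp add: work_step_def work_defs_def)

lemma sat_Disjs_rules [simp]:
  "sat n I s (Disjs (rules X) (\<lambda>(Y, Z). \<phi> Y Z)) \<longleftrightarrow> (\<exists>Y Z. (X, Y, Z) \<in> B \<and> sat n I s (\<phi> Y Z))"
  by (auto simp: rules_def[symmetric]) (auto simp: rules_def)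

text \<open>Translates the step formula into combinatorics, so that the rounds can be analysed
  without syntax. Here w is the word that the stored relations describe and w' the changed
  one.\<close>

lemma work_step_Der:
  assumes "work u = work_defs" "X \<in> V" "invariant L w A" "length w' = length w"
  shows "[i, j] \<in> work_step u w' A W (work_index (Der X)) \<longleftrightarrow>
    i < length w' \<and> j < length w' \<and>
    (span ((!) w) X i j \<and> (\<forall>r<length w'. i \<le> r \<longrightarrow> r \<le> j \<longrightarrow> w ! r = w' ! r) \<or>
     (\<exists>A \<in> V. \<exists>p<length w'. \<exists>q<length w'. [i, j, p, q] \<in> W (work_index (Gap X A)) \<and>
       (leaf ((!) w') A p q \<or>
        (\<exists>Y Z. (A, Y, Z) \<in> B \<and> (\<exists>m. Suc m < length w' \<and>
           [p, m] \<in> W (work_index (Der Y)) \<and> [Suc m, q] \<in> W (work_index (Der Z)))))))"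
proof -
  have [simp]: "[i, j] \<in> A (aux_index (Item (Der X))) \<longleftrightarrow> j < length w' \<and> span ((!) w) X i j"
    using assms by (simp add: invariant_def)
  \<comment> \<open>The end of the left child and the start of the right child are quantified
    separately; the bound on the second implies the one on the first.\<close>
  have [simp]: "(\<exists>a<n. Suc a < n \<and> P a) \<longleftrightarrow> (\<exists>a. Suc a < n \<and> P a)" for n P
    by (meson Suc_lessD)
  show ?thesis
    using assms(2) finite_V
    by (simp add: work_step_eq[OF assms(1)] defrel_def sat_Same[OF assms(3,4)] cong: conj_cong)
qed

lemma work_step_Gap:
  assumes "work u = work_defs" "X \<in> V" "Y \<in> V" "invariant L w A" "length w' = length w"
  shows "[i, j, p, q] \<in> work_step u w' A W (work_index (Gap X Y)) \<longleftrightarrow>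
    i < length w' \<and> j < length w' \<and> p < length w' \<and> q < length w' \<and>
    (gap ((!) w) X Y i j p q \<and>
       (\<forall>r<length w'. i \<le> r \<longrightarrow> r \<le> j \<longrightarrow> p \<le> r \<and> r \<le> q \<or> w ! r = w' ! r) \<or>
     (\<exists>A \<in> V. \<exists>k<length w'. \<exists>l<length w'. [i, j, k, l] \<in> W (work_index (Gap X A)) \<and>
       (A = Y \<and> pad ((!) w') k l p q \<or>
        (\<exists>C D. (A, C, D) \<in> B \<and> (\<exists>m. Suc m < length w' \<and>
           ([k, m] \<in> W (work_index (Der C)) \<and> [Suc m, l, p, q] \<in> W (work_index (Gap D Y)) \<or>
            [k, m, p, q] \<in> W (work_index (Gap C Y)) \<and> [Suc m, l] \<in> W (work_index (Der D))))))))"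
proof -
  have [simp]: "[i, j, p, q] \<in> A (aux_index (Item (Gap X Y))) \<longleftrightarrow>
      j < length w' \<and> gap ((!) w) X Y i j p q"
    using assms by (simp add: invariant_def)
  have [simp]: "(\<exists>a<n. Suc a < n \<and> P a) \<longleftrightarrow> (\<exists>a. Suc a < n \<and> P a)" for n P
    by (meson Suc_lessD)
  have [simp]: "sat n I s (if b then \<phi> else Falsum) \<longleftrightarrow> b \<and> sat n I s \<phi>" for n I s b \<phi>
    by simp
  show ?thesis
    using assms(2,3) finite_V
    by (simp add: work_step_eq[OF assms(1)] defrel_def sat_Same[OF assms(4,5)]
        cong: conj_cong if_cong)
qed


section \<open>Correctness of the program\<close>

context
  fixes L and w w' :: "'a input" and A and u :: "'a update"
  assumes u: "work u = work_defs" and inv: "invariant L w A" and len: "length w' = length w"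
begin

definition rounds :: "nat \<Rightarrow> nat \<Rightarrow> nat list set" where
  "rounds k = (work_step u w' A ^^ k) (\<lambda>_. {})"

definition changed :: "nat set" where
  "changed = {r. r < length w' \<and> w ! r \<noteq> w' ! r}"

lemma rounds_0: "rounds 0 m = {}"
  by (simp add: rounds_def)

lemma rounds_Suc: "rounds (Suc k) = work_step u w' A (rounds k)"
  by (simp add: rounds_def)

lemma finite_changed: "finite changed"
  by (simp add: changed_def)

text \<open>Copied facts stay true by locality, and all others compose facts of the previous round
  by \<open>gap_span\<close>, \<open>gap_trans\<close> and the tree rules.\<close>

lemma rounds_sound:
  "(\<forall>X \<in> V. \<forall>i j. [i, j] \<in> rounds k (work_index (Der X)) \<longrightarrow>
      j < length w' \<and> span ((!) w') X i j) \<and>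
   (\<forall>X \<in> V. \<forall>Y \<in> V. \<forall>i j p q. [i, j, p, q] \<in> rounds k (work_index (Gap X Y)) \<longrightarrow>
      j < length w' \<and> gap ((!) w') X Y i j p q)"
proof (induction k)
  case 0
  then show ?case by (simp add: rounds_0)
next
  case (Suc k)
  then have Der: "span ((!) w') X i j" if "[i, j] \<in> rounds k (work_index (Der X))" "X \<in> V" for X i j
    using that by blast
  from Suc have Gap: "gap ((!) w') X Y i j p q"
    if "[i, j, p, q] \<in> rounds k (work_index (Gap X Y))" "X \<in> V" "Y \<in> V" for X Y i j p q
    using that by blast
  have "j < length w' \<and> span ((!) w') X i j"
    if mem: "[i, j] \<in> rounds (Suc k) (work_index (Der X))" and X: "X \<in> V" for X i j
  proof -
    from mem have "j < length w'"
      unfolding rounds_Suc work_step_Der[OF u X inv len] by blast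
    from mem
    consider "span ((!) w) X i j" "\<forall>r<length w'. i \<le> r \<longrightarrow> r \<le> j \<longrightarrow> w ! r = w' ! r"
      | D p q where "D \<in> V" "[i, j, p, q] \<in> rounds k (work_index (Gap X D))" "leaf ((!) w') D p q"
      | D p q Y Z m where "D \<in> V" "[i, j, p, q] \<in> rounds k (work_index (Gap X D))" "(D, Y, Z) \<in> B"
        "[p, m] \<in> rounds k (work_index (Der Y))" "[Suc m, q] \<in> rounds k (work_index (Der Z))"
      unfolding rounds_Suc work_step_Der[OF u X inv len] by blast
    then have "span ((!) w') X i j"
    proof cases
      case 1
      with \<open>j < length w'\<close> show ?thesis by (auto intro: span_cong)
    next
      case (2 D p q)
      with Gap X show ?thesis by (blast intro: gap_span span_leaf)
    next
      case (3 D p q Y Z m)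
      then have "Y \<in> V" "Z \<in> V" using B_subset by auto
      with 3 have "span ((!) w') D p q" using span_node[OF 3(3)] Der by blast
      with 3 Gap X show ?thesis by (blast intro: gap_span)
    qed
    with \<open>j < length w'\<close> show ?thesis by blast
  qed
  moreover have "j < length w' \<and> gap ((!) w') X Y i j p q"
    if mem: "[i, j, p, q] \<in> rounds (Suc k) (work_index (Gap X Y))" and XY: "X \<in> V" "Y \<in> V" for X Y i j p q
  proof -
    from mem have "j < length w'"
      unfolding rounds_Suc work_step_Gap[OF u XY inv len] by blast
    from mem
    consider "gap ((!) w) X Y i j p q"
        "\<forall>r<length w'. i \<le> r \<longrightarrow> r \<le> j \<longrightarrow> p \<le> r \<and> r \<le> q \<or> w ! r = w' ! r"
      | l k' where "[i, j, k', l] \<in> rounds k (work_index (Gap X Y))" "pad ((!) w') k' l p q"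
      | D k' l E F m where "D \<in> V" "[i, j, k', l] \<in> rounds k (work_index (Gap X D))" "(D, E, F) \<in> B"
        "[k', m] \<in> rounds k (work_index (Der E))"
        "[Suc m, l, p, q] \<in> rounds k (work_index (Gap F Y))"
      | D k' l E F m where "D \<in> V" "[i, j, k', l] \<in> rounds k (work_index (Gap X D))" "(D, E, F) \<in> B"
        "[k', m, p, q] \<in> rounds k (work_index (Gap E Y))"
        "[Suc m, l] \<in> rounds k (work_index (Der F))"
      unfolding rounds_Suc work_step_Gap[OF u XY inv len] by blast
    then have "gap ((!) w') X Y i j p q"
    proof cases
      case 1
      from 1(1) show ?thesis
        by (rule gap_cong) (use 1(2) \<open>j < length w'\<close> in \<open>meson le_less_trans\<close>)
    next
      case (2 l k')
      with Gap XY show ?thesis by (blast intro: gap_trans gap_pad)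
    next
      case (3 D k' l E F m)
      then have "E \<in> V" "F \<in> V" using B_subset by auto
      with 3 XY have "gap ((!) w') D Y k' l p q" using gap_right[OF 3(3)] Gap Der by blast
      with 3 Gap XY show ?thesis by (blast intro: gap_trans)
    next
      case (4 D k' l E F m)
      then have "E \<in> V" "F \<in> V" using B_subset by auto
      with 4 XY have "gap ((!) w') D Y k' l p q" using gap_left[OF 4(3)] Gap Der by blast
      with 4 Gap XY show ?thesis by (blast intro: gap_trans)
    qed
    with \<open>j < length w'\<close> show ?thesis by blast
  qed
  ultimately show ?case by blast
qed

text \<open>The copying disjunct reads the stored relations, which stay fixed during the rounds; so
  the fact holds after every round from the first on.\<close>

lemma rounds_unchanged_Der:
  assumes "X \<in> V" "j < length w'" "span ((!) w') X i j" "card (changed \<inter> {i..j}) = 0" "0 < k"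
  shows "[i, j] \<in> rounds k (work_index (Der X))"
proof -
  have empty: "changed \<inter> {i..j} = {}" using assms(4) finite_changed by simp
  have eq: "w ! r = w' ! r" if "i \<le> r" "r \<le> j" for r
  proof -
    from that empty have "r \<notin> changed" by auto
    with that assms(2) show ?thesis by (simp add: changed_def)
  qed
  from \<open>0 < k\<close> obtain k' where "k = Suc k'" by (cases k) auto
  moreover have "span ((!) w) X i j" using assms(3) by (rule span_cong) (simp add: eq)
  ultimately show ?thesis
    using assms(2) span_le[OF assms(3)] eq
    by (simp add: rounds_Suc work_step_Der[OF u assms(1) inv len])
qed

lemma rounds_unchanged_Gap:
  assumes "X \<in> V" "Y \<in> V" "j < length w'" "gap ((!) w') X Y i j p q"
    "card (changed \<inter> {i..j}) - card (changed \<inter> {p..q}) = 0" "0 < k"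
  shows "[i, j, p, q] \<in> rounds k (work_index (Gap X Y))"
proof -
  note le = gap_le[OF assms(4)]
  \<comment> \<open>The changes in the hole are among those in the interval, so equally many means
    the same ones.\<close>
  have same: "changed \<inter> {p..q} = changed \<inter> {i..j}"
    using le assms(5) finite_changed by (intro card_seteq) auto
  have eq: "w ! r = w' ! r" if "i \<le> r" "r \<le> j" "\<not> (p \<le> r \<and> r \<le> q)" for r
  proof -
    from that same have "r \<notin> changed" by (metis IntD2 IntI atLeastAtMost_iff)
    with that assms(3) show ?thesis by (simp add: changed_def)
  qed
  from \<open>0 < k\<close> obtain k' where "k = Suc k'" by (cases k) auto
  moreover have "gap ((!) w) X Y i j p q" using assms(4) by (rule gap_cong) (simp add: eq)
  ultimately show ?thesis
    using assms(3) le eq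
    by (simp add: rounds_Suc work_step_Gap[OF u assms(1,2) inv len]) blast
qed

text \<open>Gaps lag one round behind spans, because the subtree branching off at the cut of a gap may
  carry all of its changes.\<close>

lemma rounds_complete:
  "(\<forall>k X i j. 2 * t + 1 \<le> k \<longrightarrow> X \<in> V \<longrightarrow> j < length w' \<longrightarrow> span ((!) w') X i j \<longrightarrow>
      card (changed \<inter> {i..j}) < 2 ^ t \<longrightarrow> [i, j] \<in> rounds k (work_index (Der X))) \<and>
   (\<forall>k X Y i j p q. 2 * t + 2 \<le> k \<longrightarrow> X \<in> V \<longrightarrow> Y \<in> V \<longrightarrow> j < length w' \<longrightarrow>
      gap ((!) w') X Y i j p q \<longrightarrow> card (changed \<inter> {i..j}) - card (changed \<inter> {p..q}) < 2 ^ t \<longrightarrow>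
      [i, j, p, q] \<in> rounds k (work_index (Gap X Y)))"
proof (induction t)
  case 0
  then show ?case by (auto intro: rounds_unchanged_Der rounds_unchanged_Gap)
next
  case (Suc t)
  let ?\<mu> = "\<lambda>i j. card (changed \<inter> {i..j})"
  from Suc have IH_Der: "[i, j] \<in> rounds k (work_index (Der X))"
    if "2 * t + 1 \<le> k" "X \<in> V" "j < length w'" "span ((!) w') X i j" "?\<mu> i j < 2 ^ t" for k X i j
    using that by blast
  from Suc have IH_Gap: "[i, j, p, q] \<in> rounds k (work_index (Gap X Y))"
    if "2 * t + 2 \<le> k" "X \<in> V" "Y \<in> V" "j < length w'" "gap ((!) w') X Y i j p q"
      "?\<mu> i j - ?\<mu> p q < 2 ^ t" for k X Y i j p q
    using that by blast
  have Der: "[i, j] \<in> rounds k (work_index (Der X))"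
    if k: "2 * Suc t + 1 \<le> k" and X: "X \<in> V" and j: "j < length w'" and span: "span ((!) w') X i j"
      and less: "?\<mu> i j < 2 ^ Suc t" for k X i j
  proof (cases "?\<mu> i j < 2 ^ t")
    case True
    with that show ?thesis by (intro IH_Der) auto
  next
    case False
    \<comment> \<open>One round is spent on the cut, leaving just enough for the gap of level t,
      which needs one round more than the spans.\<close>
    from k obtain k' where k': "k = Suc k'" "2 * t + 2 \<le> k'" by (cases k) auto
    from False[unfolded not_less] span_halve[OF finite_changed span, of "2 ^ t"] obtain D p q
      where gap: "gap ((!) w') X D i j p q" and ge: "2 ^ t \<le> ?\<mu> p q"
        and D: "leaf ((!) w') D p q \<or> (\<exists>Y Z m. (D, Y, Z) \<in> B \<and> span ((!) w') Y p m \<and>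
          span ((!) w') Z (Suc m) q \<and> ?\<mu> p m < 2 ^ t \<and> ?\<mu> (Suc m) q < 2 ^ t)"
      by blast
    note le = gap_le[OF gap]
    have "D \<in> V" using gap_V[OF gap X] .
    \<comment> \<open>Fewer than \<open>2 ^ Suc t\<close> changes in total, at least
      \<open>2 ^ t\<close> of them in the hole, leave fewer than \<open>2 ^ t\<close> for the
      gap.\<close>
    have "[i, j, p, q] \<in> rounds k' (work_index (Gap X D))"
      using k' X \<open>D \<in> V\<close> j gap ge less by (intro IH_Gap) auto
    moreover from D have "leaf ((!) w') D p q \<or> (\<exists>Y Z. (D, Y, Z) \<in> B \<and> (\<exists>m. Suc m < length w' \<and>
        [p, m] \<in> rounds k' (work_index (Der Y)) \<and> [Suc m, q] \<in> rounds k' (work_index (Der Z))))"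
    proof
      assume "\<exists>Y Z m. (D, Y, Z) \<in> B \<and> span ((!) w') Y p m \<and>
          span ((!) w') Z (Suc m) q \<and> ?\<mu> p m < 2 ^ t \<and> ?\<mu> (Suc m) q < 2 ^ t"
      then obtain Y Z m where m: "(D, Y, Z) \<in> B" "span ((!) w') Y p m" "span ((!) w') Z (Suc m) q"
        "?\<mu> p m < 2 ^ t" "?\<mu> (Suc m) q < 2 ^ t" by blast
      then have "Y \<in> V" "Z \<in> V" using B_subset by auto
      moreover have "Suc m < length w'" using span_le[OF m(3)] le j by simp
      moreover have "[p, m] \<in> rounds k' (work_index (Der Y))" "[Suc m, q] \<in> rounds k' (work_index (Der Z))"
        using m k' le j \<open>Suc m < length w'\<close> \<open>Y \<in> V\<close> \<open>Z \<in> V\<close> by (auto intro!: IH_Der)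
      ultimately show ?thesis using m(1) by blast
    qed blast
    ultimately show ?thesis
      unfolding k' rounds_Suc work_step_Der[OF u X inv len]
      using \<open>D \<in> V\<close> le j by (meson le_less_trans order_trans)
  qed
  moreover have "[i, j, p, q] \<in> rounds k (work_index (Gap X Y))"
    if k: "2 * Suc t + 2 \<le> k" and X: "X \<in> V" and Y: "Y \<in> V" and j: "j < length w'"
      and gap: "gap ((!) w') X Y i j p q" and less: "?\<mu> i j - ?\<mu> p q < 2 ^ Suc t" for k X Y i j p q
  proof (cases "?\<mu> i j - ?\<mu> p q < 2 ^ t")
    case True
    with that show ?thesis by (intro IH_Gap) auto
  next
    case False
    note le0 = gap_le[OF gap]
    \<comment> \<open>The remaining rounds suffice for spans of level \<open>Suc t\<close>, which
      the sibling subtree requires.\<close>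
    from k obtain k' where k': "k = Suc k'" "2 * Suc t + 1 \<le> k'" by (cases k) auto
    from False[unfolded not_less] gap_halve[OF finite_changed gap, of "2 ^ t"] obtain D a b
      where outer: "gap ((!) w') X D i j a b" and ge: "2 ^ t \<le> ?\<mu> a b - ?\<mu> p q"
        and D: "D = Y \<and> pad ((!) w') a b p q \<or>
          (\<exists>E F m. (D, E, F) \<in> B \<and>
            (span ((!) w') E a m \<and> gap ((!) w') F Y (Suc m) b p q \<and>
               ?\<mu> (Suc m) b - ?\<mu> p q < 2 ^ t \<or>
             gap ((!) w') E Y a m p q \<and> span ((!) w') F (Suc m) b \<and> ?\<mu> a m - ?\<mu> p q < 2 ^ t))"
      by blast
    note le = gap_le[OF outer]
    have "D \<in> V" using gap_V[OF outer X] .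
    have "[i, j, a, b] \<in> rounds k' (work_index (Gap X D))"
      using k' X \<open>D \<in> V\<close> j outer ge less by (intro IH_Gap) auto
    moreover from D have "D = Y \<and> pad ((!) w') a b p q \<or>
        (\<exists>E F. (D, E, F) \<in> B \<and> (\<exists>m. Suc m < length w' \<and>
          ([a, m] \<in> rounds k' (work_index (Der E)) \<and>
             [Suc m, b, p, q] \<in> rounds k' (work_index (Gap F Y)) \<or>
           [a, m, p, q] \<in> rounds k' (work_index (Gap E Y)) \<and>
             [Suc m, b] \<in> rounds k' (work_index (Der F)))))"
    proof (elim disjE exE conjE)
      fix E F m
      assume m: "(D, E, F) \<in> B" "span ((!) w') E a m" "gap ((!) w') F Y (Suc m) b p q"
        "?\<mu> (Suc m) b - ?\<mu> p q < 2 ^ t"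
      note le' = gap_le[OF m(3)] span_le[OF m(2)]
      from m(1) have "E \<in> V" "F \<in> V" using B_subset by auto
      have "Suc m < length w'" using le' le j by simp
      \<comment> \<open>The sibling lies outside the hole, so its changes are among those of the
        gap: fewer than \<open>2 ^ Suc t\<close>. It is therefore covered by \<open>Der\<close> just
        proved, not by the induction hypothesis.\<close>
      have "?\<mu> a m + ?\<mu> (Suc m) b = ?\<mu> a b"
        using le' by (intro card_atLeastAtMost_split[symmetric] finite_changed) auto
      moreover have "?\<mu> p q \<le> ?\<mu> (Suc m) b" "?\<mu> a b \<le> ?\<mu> i j"
        using le le' by (auto intro!: card_interval_mono finite_changed)
      ultimately have "?\<mu> a m < 2 ^ Suc t" using less by linarith
      then have "[a, m] \<in> rounds k' (work_index (Der E))"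
        using \<open>E \<in> V\<close> \<open>Suc m < length w'\<close> k' m by (intro Der) auto
      moreover have "[Suc m, b, p, q] \<in> rounds k' (work_index (Gap F Y))"
        using \<open>F \<in> V\<close> Y k' m le j by (intro IH_Gap) auto
      ultimately show ?thesis using m(1) \<open>Suc m < length w'\<close> by blast
    next
      fix E F m
      assume m: "(D, E, F) \<in> B" "gap ((!) w') E Y a m p q" "span ((!) w') F (Suc m) b"
        "?\<mu> a m - ?\<mu> p q < 2 ^ t"
      note le' = gap_le[OF m(2)] span_le[OF m(3)]
      from m(1) have "E \<in> V" "F \<in> V" using B_subset by auto
      have "Suc m < length w'" using le' le j by simp
      have "?\<mu> a m + ?\<mu> (Suc m) b = ?\<mu> a b"
        using le' by (intro card_atLeastAtMost_split[symmetric] finite_changed) auto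
      moreover have "?\<mu> p q \<le> ?\<mu> a m" "?\<mu> a b \<le> ?\<mu> i j"
        using le le' by (auto intro!: card_interval_mono finite_changed)
      ultimately have "?\<mu> (Suc m) b < 2 ^ Suc t" using less by linarith
      then have "[Suc m, b] \<in> rounds k' (work_index (Der F))"
        using \<open>F \<in> V\<close> k' m le j by (intro Der) auto
      moreover have "[a, m, p, q] \<in> rounds k' (work_index (Gap E Y))"
        using \<open>E \<in> V\<close> Y k' m \<open>Suc m < length w'\<close> by (intro IH_Gap) auto
      ultimately show ?thesis using m(1) \<open>Suc m < length w'\<close> by blast
    qed simp
    moreover have "i < length w'" "p < length w'" "q < length w'" "a < length w'" "b < length w'"
      using le0 le j by auto
    ultimately show ?thesis
      unfolding k' rounds_Suc work_step_Gap[OF u X Y inv len]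
      using j \<open>D \<in> V\<close> by blast
  qed
  ultimately show ?case by blast
qed

lemma card_changed_le: "card (changed \<inter> K) \<le> card changed"
  by (intro card_mono finite_changed) auto

lemma rounds_Der:
  assumes "card changed < 2 ^ t" "2 * t + 2 \<le> k" "X \<in> V"
  shows "[i, j] \<in> rounds k (work_index (Der X)) \<longleftrightarrow> j < length w' \<and> span ((!) w') X i j"
proof -
  have "card (changed \<inter> {i..j}) < 2 ^ t"
    using card_changed_le[of "{i..j}"] assms(1) by linarith
  moreover have "2 * t + 1 \<le> k" using assms(2) by simp
  ultimately show ?thesis using assms(3) rounds_sound[of k] rounds_complete[of t] by blast
qed

lemma rounds_Gap:
  assumes "card changed < 2 ^ t" "2 * t + 2 \<le> k" "X \<in> V" "Y \<in> V"
  shows "[i, j, p, q] \<in> rounds k (work_index (Gap X Y)) \<longleftrightarrow>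
    j < length w' \<and> gap ((!) w') X Y i j p q"
proof -
  have "card (changed \<inter> {i..j}) - card (changed \<inter> {p..q}) < 2 ^ t"
    using card_changed_le[of "{i..j}"] assms(1) by linarith
  with assms show ?thesis using rounds_sound[of k] rounds_complete[of t] by blast
qed

end

section \<open>Initialisation and preservation of the invariant\<close>

lemma generates_word_of:
  "generates B T X (word_of w) \<longleftrightarrow> length w \<noteq> 0 \<and> span ((!) w) X 0 (length w - 1)"
proof (cases "length w = 0")
  case True
  then show ?thesis using generates_nonempty[of B T X "[]"] by (auto simp: word_of_def)
next
  case False
  then have "[0..<length w] = [0..<Suc (length w - 1)]" by simp
  then have "span ((!) w) X 0 (length w - 1) \<Longrightarrow> generates B T X (word_of w)"
    unfolding word_of_eq by (metis span_imp_generates)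
  with False generates_imp_span[of X "word_of w" "(!) w" 0 "length w", OF _ word_of_eq[symmetric]]
  show ?thesis by blast
qed

text \<open>Without letters there is no leaf and hence no span; a gap can then arise from
  \<open>gap_pad\<close> only, since the other rules need a span of the sibling.\<close>

lemma invariant_init:
  assumes "w = empty_input (length w)"
  shows "invariant L w (init_aux (program ([] \<in> L) k) (length w))"
proof -
  have init: "init_aux (program e k) (length w) (aux_index r) =
      defrel (length w) (letter_rel w) (stored_arity r) (init_fo e r)" if "r \<in> stored_rels" for e r
    using aux_index_nth[OF that] assms by (simp add: init_aux_def program_def)
  have blank: "w ! p = None" if "p < length w" for p
    using that assms by (metis empty_input_def nth_replicate)
  have no_span: "\<not> span ((!) w) X i j" if "j < length w" for X i j
  proof
    assume *: "span ((!) w) X i j"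
    have "List.map_filter ((!) w) [i..<Suc j] = []"
      using that blank by (auto simp: List.map_filter_def filter_empty_conv)
    with span_imp_generates[OF *] generates_nonempty show False by metis
  qed
  have gap_iff: "gap ((!) w) X Y i j p q \<longleftrightarrow> X = Y \<and> i \<le> p \<and> p \<le> q \<and> q \<le> j"
    if "j < length w" for X Y i j p q
  proof
    assume g: "gap ((!) w) X Y i j p q"
    then have "X = Y" using that
    proof cases
      case (gap_right Y' Z m)
      with no_span[of m] that gap_le[OF gap_right(3)] show ?thesis by auto
    next
      case (gap_left Y' Z m)
      with no_span[of j] that show ?thesis by auto
    qed simp
    with gap_le[OF g] show "X = Y \<and> i \<le> p \<and> p \<le> q \<and> q \<le> j" by simp
  next
    assume "X = Y \<and> i \<le> p \<and> p \<le> q \<and> q \<le> j"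
    with that blank show "gap ((!) w) X Y i j p q" by (auto intro!: gap_pad simp: pad_def)
  qed
  have "word_of w = []" using blank by (simp add: word_of_eq_Nil)
  then show ?thesis
    unfolding invariant_def
    by (auto simp: init defrel_def no_span gap_iff blank)
qed

lemma invariant_next:
  assumes inv: "invariant L w A" and len: "length w' = length w"
    and L: "\<And>v. v \<noteq> [] \<Longrightarrow> v \<in> L \<longleftrightarrow> generates B T S v"
    and few: "card {r. r < length w' \<and> w ! r \<noteq> w' ! r} < 2 ^ t"
    and k: "2 * t + 2 \<le> k * (loglog (length w') + 1)"
  shows "invariant L w' (next_aux (program ([] \<in> L) k) w' A)"
proof -
  let ?e = "[] \<in> L"
  define u where "u = (\<lambda>r. \<lparr>work = work_defs, iters = k, result = result_fo ?e r\<rparr>)"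
  \<comment> \<open>All auxiliary relations share the same work relations, so the final work
    relations computed for \<open>Answer\<close> serve for each of them.\<close>
  define W where "W = (work_step (u Answer) w' A ^^ (k * (loglog (length w') + 1))) (\<lambda>_. {})"
  have W: "(work_step (u r) w' A ^^ (k * (loglog (length w') + 1))) (\<lambda>_. {}) = W" for r
  proof -
    have "work (u r) = work_defs" for r by (simp add: u_def)
    then have "work_step (u r) w' A = work_step (u Answer) w' A"
      by (intro ext) (simp only: work_step_def)
    then show ?thesis by (simp only: W_def)
  qed
  have "next_aux (program ?e k) w' A (aux_index r) =
      run_update (stored_arity r) (u r) w' A" if "r \<in> stored_rels" for r
    using aux_index_nth[OF that] by (simp add: next_aux_def program_def u_def)
  then have nxt: "next_aux (program ?e k) w' A (aux_index r) =
      defrel (length w') (interp w' A W) (stored_arity r) (result_fo ?e r)"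
    if "r \<in> stored_rels" for r
    using that W[of r] by (simp add: run_update_def u_def)
  have u: "work (u Answer) = work_defs" by (simp add: u_def)
  note rounds = rounds_def[OF u inv len] changed_def[OF u inv len]
  have Der: "[i, j] \<in> W (work_index (Der X)) \<longleftrightarrow> j < length w' \<and> span ((!) w') X i j"
    if "X \<in> V" for X i j
    using rounds_Der[OF u inv len _ k that] few by (simp add: rounds W_def)
  have Gap: "[i, j, p, q] \<in> W (work_index (Gap X Y)) \<longleftrightarrow> j < length w' \<and> gap ((!) w') X Y i j p q"
    if "X \<in> V" "Y \<in> V" for X Y i j p q
    using rounds_Gap[OF u inv len _ k that] few by (simp add: rounds W_def)
  have upt: "[0..<2] = [0, 1]" "[0..<4] = [0, 1, 2, 3::nat]" by (simp_all add: upt_rec)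
  have "[i, j] \<in> next_aux (program ?e k) w' A (aux_index (Item (Der X))) \<longleftrightarrow>
      j < length w' \<and> span ((!) w') X i j" if "X \<in> V" for X i j
    using that span_le[of "(!) w'" X i j] by (auto simp: nxt defrel_def upt Der)
  moreover have "[i, j, p, q] \<in> next_aux (program ?e k) w' A (aux_index (Item (Gap X Y))) \<longleftrightarrow>
      j < length w' \<and> gap ((!) w') X Y i j p q" if "X \<in> V" "Y \<in> V" for X Y i j p q
    using that gap_le[of "(!) w'" X Y i j p q] by (auto simp: nxt defrel_def upt Gap)
  moreover have "[p] \<in> next_aux (program ?e k) w' A (aux_index (Old a)) \<longleftrightarrow>
      p < length w' \<and> w' ! p = Some a" for a p
    by (auto simp: nxt defrel_def letter_rel_def)
  moreover have "[] \<in> next_aux (program ?e k) w' A (aux_index Answer) \<longleftrightarrow> word_of w' \<in> L"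
  proof -
    have "[] \<in> next_aux (program ?e k) w' A (aux_index Answer) \<longleftrightarrow>
        ?e \<and> (\<forall>r<length w'. w' ! r = None) \<or>
        (\<exists>i<length w'. \<exists>j<length w'. (\<forall>r<length w'. i \<le> r \<and> r \<le> j) \<and> span ((!) w') S i j)"
      by (auto simp: nxt defrel_def Der S_V)
    also have "(\<exists>i<length w'. \<exists>j<length w'. (\<forall>r<length w'. i \<le> r \<and> r \<le> j) \<and> span ((!) w') S i j) \<longleftrightarrow>
        generates B T S (word_of w')"
    proof (cases "length w' = 0")
      case False
      show ?thesis unfolding generates_word_of
      proof
        assume "\<exists>i<length w'. \<exists>j<length w'. (\<forall>r<length w'. i \<le> r \<and> r \<le> j) \<and> span ((!) w') S i j"
        then obtain i j where ij: "j < length w'" "\<forall>r<length w'. i \<le> r \<and> r \<le> j"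
          and span: "span ((!) w') S i j" by blast
        have "i = 0" "j = length w' - 1"
          using False ij(1) ij(2)[rule_format, of 0] ij(2)[rule_format, of "length w' - 1"] by auto
        with span False show "length w' \<noteq> 0 \<and> span ((!) w') S 0 (length w' - 1)" by simp
      next
        assume *: "length w' \<noteq> 0 \<and> span ((!) w') S 0 (length w' - 1)"
        show "\<exists>i<length w'. \<exists>j<length w'. (\<forall>r<length w'. i \<le> r \<and> r \<le> j) \<and> span ((!) w') S i j"
          by (rule exI[of _ 0], rule conjI, use * in simp, rule exI[of _ "length w' - 1"]) (use * in auto)
      qed
    qed (simp add: generates_word_of)
    also have "?e \<and> (\<forall>r<length w'. w' ! r = None) \<or> generates B T S (word_of w') \<longleftrightarrow> word_of w' \<in> L"
      using L[of "word_of w'"] generates_nonempty[of B T S "word_of w'"]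
      unfolding word_of_eq_Nil[symmetric] by (cases "word_of w' = []") auto
    finally show ?thesis .
  qed
  ultimately show ?thesis unfolding invariant_def by blast
qed

end

section \<open>The number of rounds and the theorem\<close>

text \<open>For n \<le> 1 the double logarithm is degenerate and \<open>m \<le> n\<close> gives the
  bound. Otherwise \<open>log 2 n \<le> 2 ^ loglog n\<close>, and the summand 1 in the exponent
  makes the inequality strict.\<close>

lemma log_power_less:
  assumes "real m \<le> log 2 (real n) ^ c" "m \<le> n"
  shows "m < 2 ^ (c * loglog n + 1)"
proof (cases "n \<le> 1")
  case True
  then have "m \<le> 1" using assms(2) by simp
  also have "(1::nat) < 2 ^ (c * loglog n + 1)" by (rule one_less_power) auto
  finally show ?thesis .
next
  case False
  then have pos: "0 < log 2 (real n)" by simp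
  have "log 2 (log 2 (real n)) \<le> real (loglog n)"
    unfolding loglog_def by linarith
  then have "log 2 (real n) \<le> 2 ^ loglog n"
    using pos by (simp add: log_le_iff powr_realpow)
  then have "log 2 (real n) ^ c \<le> (2 ^ loglog n) ^ c"
    using pos by (intro power_mono) auto
  also have "\<dots> = 2 ^ (c * loglog n)"
    by (simp add: power_mult[symmetric] mult.commute)
  finally have "real m \<le> 2 ^ (c * loglog n)" using assms(1) by linarith
  then have "m \<le> 2 ^ (c * loglog n)" by simp
  also have "\<dots> < 2 ^ (c * loglog n + 1)" by simp
  finally show ?thesis .
qed

theorem theorem9:
  fixes L :: "'a::finite list set" and c :: nat
  assumes "context_free L"
  shows "L \<in> DynFOLL (\<lambda>n. log 2 (real n) ^ c)"
proof -
  obtain V :: "(nat, 'a) symb list set" and B T S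
    where nf: "finite V" "B \<subseteq> V \<times> V \<times> V" "S \<in> V"
      and L: "\<And>w. w \<noteq> [] \<Longrightarrow> w \<in> L \<longleftrightarrow> generates B T S w"
    by (rule context_free_normal_form[OF assms]) (rule that)
  interpret normal_form V B T S by (unfold_locales) (use nf in auto)
  \<comment> \<open>Writing l for \<open>loglog n\<close>, the level t = c * l + 1 needs 2 * t + 2 =
    2 * c * l + 4 rounds, which is at most (2 * c + 4) * (l + 1).\<close>
  let ?P = "program ([] \<in> L) (2 * c + 4)"
  have inv: "length w = n \<and> invariant L w A" if "reach ?P (log 2 (real n) ^ c) n w A" for n w A
    using that
  proof induction
    case start
    show ?case
      using invariant_init[of "empty_input n" L] by (simp add: empty_input_def)
  next
    case (step w A w')
    let ?C = "{r. r < length w' \<and> w ! r \<noteq> w' ! r}"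
    from step have len: "length w' = length w" "length w' = n"
      and "real (card ?C) \<le> log 2 (real n) ^ c"
      by (auto simp: change_def)
    \<comment> \<open>This bound serves the inputs of size at most 1 in
      \<open>log_power_less\<close>.\<close>
    moreover have "card ?C \<le> n" using card_mono[of "{..<n}" ?C] len by auto
    ultimately have "card ?C < 2 ^ (c * loglog n + 1)" by (intro log_power_less)
    moreover have "2 * (c * loglog n + 1) + 2 \<le> (2 * c + 4) * (loglog n + 1)"
      by (simp add: algebra_simps)
    ultimately show ?case
      using step.IH len
      by (intro conjI invariant_next[OF _ len(1) L, where t = "c * loglog n + 1"]) simp_all
  qed
  have "maintains ?P (\<lambda>n. log 2 (real n) ^ c) L"
    unfolding maintains_def using inv by (auto simp: invariant_def program_def)
  with wf_program show ?thesis by (auto simp: DynFOLL_def)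
qed

end
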